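(* Let $N\ge 5$ and write $x=(x',x_N)\in\mathbb{R}^{N-1}\times\mathbb{R}$. Let $f\in C^2(\mathbb{R})$ be such that $f(0)=0$ and, for some $\varepsilon>0$, $f'(s)\le 0$ for all $s\in(0,\varepsilon)$. Let $u>0$ be a bounded solution to $-\Delta u=f(u)$ in $\mathbb{R}^N$. Assume that $$u(x',x_N)\to 0\quad\text{as }|x'|\to\infty,\text{ uniformly in }x_N,$$ and that, for some $x'_0\in\mathbb{R}^{N-1}$, $$u(x'_0,x_N)\to 0\quad\text{as }x_N\to\infty.$$ Then $u$ is radially symmetric, that is, there exists $y\in\mathbb{R}^N$ such that $u(x)$ depends only on $|x-y|$.
   Context: Solutions are classical ($C^2$). *)

theory Defs
  imports "HOL-Analysis.Analysis"
begin

definition partial_deriv :: "'a::euclidean_space \<Rightarrow> ('a \<Rightarrow> real) \<Rightarrow> 'a \<Rightarrow> real" where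
  "partial_deriv b u x = deriv (\<lambda>t. u (x + t *\<^sub>R b)) 0"

text \<open>
  \<open>C_k k u\<close>: all partial derivatives of \<open>u\<close> up to order \<open>k\<close> exist and are continuous on
  the whole space. Existence is demanded separately, because \<^const>\<open>deriv\<close> is total.
\<close>

primrec C_k :: "nat \<Rightarrow> ('a::euclidean_space \<Rightarrow> real) \<Rightarrow> bool" where
  "C_k 0 u \<longleftrightarrow> continuous_on UNIV u"
| "C_k (Suc k) u \<longleftrightarrow> continuous_on UNIV u \<and>
     (\<forall>b\<in>Basis. (\<forall>x. (\<lambda>t::real. u (x + t *\<^sub>R b)) field_differentiable (at 0)) \<and>
                C_k k (partial_deriv b u))"

definition laplacian :: "('a::euclidean_space \<Rightarrow> real) \<Rightarrow> 'a \<Rightarrow> real" where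
  "laplacian u x = (\<Sum>b\<in>Basis. partial_deriv b (partial_deriv b u) x)"

text \<open>On the real line, where \<^term>\<open>Basis = {1::real}\<close>, the partial derivative is the usual one.\<close>

lemma partial_deriv_real: "partial_deriv 1 f = deriv (f :: real \<Rightarrow> real)"
proof
  fix x
  have "(f has_field_derivative D) (at x) \<longleftrightarrow> ((\<lambda>t. f (x + t)) has_field_derivative D) (at 0)" for D
    using DERIV_shift[of f D 0 x] by (simp add: add.commute)
  then show "partial_deriv 1 f x = deriv f x"
    by (simp add: partial_deriv_def deriv_def)
qed

end

theory Submission
  imports Defs
begin

text \<open>
  Harnack-type barriers upgrade the decay of \<open>u\<close> along one vertical line to decay as
  \<open>x\<^sub>N \<rightarrow> \<infinity>\<close>, uniformly in \<open>x'\<close>. Hence, for every unit vector \<open>e\<close> with \<open>e\<^sub>N > 0\<close>, \<open>u\<close> vanishes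
  at infinity inside each half space \<open>{x. x \<bullet> e \<ge> c}\<close>, and the method of moving planes runs in the
  direction \<open>e\<close>: either \<open>u\<close> is symmetric about a hyperplane orthogonal to \<open>e\<close>, or \<open>u\<close> is
  nonincreasing along \<open>e\<close>. If the second alternative held for all such \<open>e\<close>, it would hold by continuity
  for all horizontal \<open>e\<close>, so \<open>u\<close> would be independent of \<open>x'\<close>, contradicting the lateral decay.
  Therefore some reflection with \<open>e\<^sub>N > 0\<close> preserves \<open>u\<close>; it transports the decay to the
  opposite half space, so \<open>u\<close> vanishes at infinity and moving planes apply in every direction.
\<close>

section \<open>Pointwise Laplacian\<close>

text \<open>The hypothesis allows \<open>f' = 0\<close> near 0, so at a negative minimum of the
  reflected difference the equation gives only a weak inequality and no pointwise contradiction.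
  Therefore the minimiser nearest to the plane is taken, and the strong minimum principle produces
  one still nearer. Thus a negative value somewhere forces a negative value at a point where
  \<open>u \<ge> \<epsilon>\<close>; with decay in the half space, such points are trapped in a
  compact set. A single barrier, a Gaussian minus its boundary value, compared on annuli, yields the
  strong minimum principle, Hopf's lemma and the propagation of lower bounds. Decay spreads sideways
  from one line because the propagation constant depends on distance and not on height:
  \<open>f 0 = 0\<close> and the Lipschitz bound give \<Delta>u \<le> L u with a constant L.
  Propagation must start from a ball of uniform radius on which \<open>u\<close> stays large; this
  is why a Lipschitz bound for functions with bounded Laplacian is proved.\<close>

text \<open>
  The Hessian is encoded by limits of symmetric second differences along lines, so that affine
  isometries and sums need no chain rule and minima need no first derivatives.
\<close>

definition has_lap :: "('a::euclidean_space \<Rightarrow> real) \<Rightarrow> real \<Rightarrow> 'a \<Rightarrow> bool" where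
  "has_lap w l x \<longleftrightarrow> (\<exists>A. linear A \<and>
     (\<forall>v. ((\<lambda>t::real. (w (x + t *\<^sub>R v) + w (x - t *\<^sub>R v) - 2 * w x) / t\<^sup>2) \<longlongrightarrow> v \<bullet> A v) (at 0)) \<and>
     l = (\<Sum>b\<in>Basis. b \<bullet> A b))"

text \<open>One application of l'Hopital's rule leaves \<open>(d t - d (- t)) / (2 * t)\<close>, the
  mean of two difference quotients of \<open>d\<close> at 0.\<close>

lemma symmetric_second_difference:
  fixes g d :: "real \<Rightarrow> real"
  assumes g: "\<And>t. (g has_real_derivative d t) (at t)" and d: "(d has_real_derivative D) (at 0)"
  shows "((\<lambda>t. (g t + g (- t) - 2 * g 0) / t\<^sup>2) \<longlongrightarrow> D) (at 0)"
proof -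
  have d1: "((\<lambda>t. (d t - d 0) / t) \<longlongrightarrow> D) (at 0)"
    using d by (simp add: DERIV_def)
  have "filterlim uminus (at (0::real)) (at 0)"
    unfolding filterlim_at
    by (auto intro!: tendsto_eq_intros eventually_at_filter[THEN iffD2])
  from filterlim_compose[OF d1 this]
  have d2: "((\<lambda>t. (d (-t) - d 0) / (-t)) \<longlongrightarrow> D) (at 0)" .
  have eq: "((d t - d 0) / t + (d (-t) - d 0) / (-t)) / 2 = (d t - d (-t)) / (2 * t)" for t
    by (cases "t = 0") (auto simp: field_simps)
  have lim: "((\<lambda>t. (d t - d (-t)) / (2 * t)) \<longlongrightarrow> D) (at 0)"
    using tendsto_divide[OF tendsto_add[OF d1 d2] tendsto_const[of 2]]
    unfolding eq by simp
  have gm: "((\<lambda>t. g (- t)) has_real_derivative - d (- t)) (at t)" for t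
  proof -
    have "(uminus has_real_derivative - 1) (at t)" by (auto intro!: derivative_eq_intros)
    from DERIV_chain2[of g "d (- t)" uminus t "- 1" UNIV, OF g this] show ?thesis by simp
  qed
  have cont: "isCont g 0" using g DERIV_isCont by blast
  have cont2: "isCont (\<lambda>t. g (- t)) 0" using gm DERIV_isCont by blast
  have z: "((\<lambda>t. g t + g (- t) - 2 * g 0) \<longlongrightarrow> 0) (at 0)"
    using cont cont2 by (auto simp: isCont_def intro!: tendsto_eq_intros)
  show ?thesis
  proof (rule lhopital[OF z])
    show "((\<lambda>t::real. t\<^sup>2) \<longlongrightarrow> 0) (at 0)" by (auto intro!: tendsto_eq_intros)
    show "\<forall>\<^sub>F t::real in at 0. t\<^sup>2 \<noteq> 0" by (auto simp: eventually_at_filter)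
    show "\<forall>\<^sub>F t::real in at 0. 2 * t \<noteq> 0" by (auto simp: eventually_at_filter)
    show "\<forall>\<^sub>F t in at 0. ((\<lambda>t. g t + g (- t) - 2 * g 0) has_real_derivative (d t - d (-t))) (at t)"
      by (rule always_eventually) (auto intro!: derivative_eq_intros g gm)
    show "\<forall>\<^sub>F t::real in at 0. ((\<lambda>t. t\<^sup>2) has_real_derivative 2 * t) (at t)"
      by (rule always_eventually) (auto intro!: derivative_eq_intros)
    show "((\<lambda>t. (d t - d (-t)) / (2 * t)) \<longlongrightarrow> D) (at 0)" by (rule lim)
  qed
qed

lemma has_lapI:
  assumes "linear A"
    and "\<And>v t. ((\<lambda>t. w (x + t *\<^sub>R v)) has_real_derivative d v t) (at t)"
    and "\<And>v. (d v has_real_derivative v \<bullet> A v) (at 0)"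
    and "l = (\<Sum>b\<in>Basis. b \<bullet> A b)"
  shows "has_lap w l x"
  unfolding has_lap_def
  using symmetric_second_difference[OF assms(2,3)] assms(1,4)
  by (intro exI[of _ A]) auto

lemma has_lap_const: "has_lap (\<lambda>x. c) 0 x"
  by (rule has_lapI[where A="\<lambda>v. 0" and d="\<lambda>v t. 0"]) (auto simp: linear_iff)

lemma has_lap_add:
  assumes "has_lap v k x" "has_lap w l x"
  shows "has_lap (\<lambda>x. v x + w x) (k + l) x"
proof -
  obtain A B where A: "linear A" "k = (\<Sum>b\<in>Basis. b \<bullet> A b)"
      "\<And>h. ((\<lambda>t::real. (v (x + t *\<^sub>R h) + v (x - t *\<^sub>R h) - 2 * v x) / t\<^sup>2) \<longlongrightarrow> h \<bullet> A h) (at 0)"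
    and B: "linear B" "l = (\<Sum>b\<in>Basis. b \<bullet> B b)"
      "\<And>h. ((\<lambda>t::real. (w (x + t *\<^sub>R h) + w (x - t *\<^sub>R h) - 2 * w x) / t\<^sup>2) \<longlongrightarrow> h \<bullet> B h) (at 0)"
    using assms unfolding has_lap_def by blast
  show ?thesis
    unfolding has_lap_def
  proof (intro exI conjI allI)
    show "linear (\<lambda>h. A h + B h)" using A B by (intro linear_compose_add)
    show "k + l = (\<Sum>b\<in>Basis. b \<bullet> (A b + B b))"
      by (simp add: A B inner_add_right sum.distrib)
    fix h
    show "((\<lambda>t::real. (v (x + t *\<^sub>R h) + w (x + t *\<^sub>R h) + (v (x - t *\<^sub>R h) + w (x - t *\<^sub>R h)) - 2 * (v x + w x)) / t\<^sup>2)
       \<longlongrightarrow> h \<bullet> (A h + B h)) (at 0)"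
      using tendsto_add[OF A(3)[of h] B(3)[of h]]
      by (simp add: inner_add_right add_divide_distrib diff_divide_distrib algebra_simps)
  qed
qed

lemma has_lap_cmult:
  assumes "has_lap w l x"
  shows "has_lap (\<lambda>x. c * w x) (c * l) x"
proof -
  obtain B where B: "linear B" "l = (\<Sum>b\<in>Basis. b \<bullet> B b)"
      "\<And>h. ((\<lambda>t::real. (w (x + t *\<^sub>R h) + w (x - t *\<^sub>R h) - 2 * w x) / t\<^sup>2) \<longlongrightarrow> h \<bullet> B h) (at 0)"
    using assms unfolding has_lap_def by blast
  show ?thesis
    unfolding has_lap_def
  proof (intro exI conjI allI)
    show "linear (\<lambda>h. c *\<^sub>R B h)" using B by (intro linear_compose_scale_right)
    show "c * l = (\<Sum>b\<in>Basis. b \<bullet> (c *\<^sub>R B b))"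
      by (simp add: B sum_distrib_left)
    fix h
    have "(c * w (x + t *\<^sub>R h) + c * w (x - t *\<^sub>R h) - 2 * (c * w x)) / t\<^sup>2
        = c * ((w (x + t *\<^sub>R h) + w (x - t *\<^sub>R h) - 2 * w x) / t\<^sup>2)" for t :: real
      by (simp add: right_diff_distrib distrib_left)
    then show "((\<lambda>t::real. (c * w (x + t *\<^sub>R h) + c * w (x - t *\<^sub>R h) - 2 * (c * w x)) / t\<^sup>2)
       \<longlongrightarrow> h \<bullet> (c *\<^sub>R B h)) (at 0)"
      using tendsto_mult_left[OF B(3)[of h], of c] by (simp only: inner_scaleR_right)
  qed
qed

lemma has_lap_diff:
  assumes "has_lap v k x" "has_lap w l x"
  shows "has_lap (\<lambda>x. v x - w x) (k - l) x"
  using has_lap_add[OF assms(1) has_lap_cmult[OF assms(2), of "-1"]] by simp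

lemma has_lap_norm_square:
  fixes x :: "'a::euclidean_space"
  shows "has_lap (\<lambda>x. (norm (x - c))\<^sup>2) (2 * DIM('a)) x"
proof (rule has_lapI[where A="\<lambda>v. 2 *\<^sub>R v" and d="\<lambda>v t. 2 * ((x - c + t *\<^sub>R v) \<bullet> v)"])
  show "linear (\<lambda>v::'a. 2 *\<^sub>R v)" by (simp add: linear_iff algebra_simps)
  show "real (2 * DIM('a)) = (\<Sum>b\<in>Basis. b \<bullet> (2 *\<^sub>R b :: 'a))" by simp
  fix v t
  have q: "(norm (x + t *\<^sub>R v - c))\<^sup>2 = (x - c) \<bullet> (x - c) + 2 * t * ((x - c) \<bullet> v) + t\<^sup>2 * (v \<bullet> v)" for t
    unfolding power2_norm_eq_inner
    by (simp add: algebra_simps inner_commute power2_eq_square)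
  show "((\<lambda>t. (norm (x + t *\<^sub>R v - c))\<^sup>2) has_real_derivative 2 * ((x - c + t *\<^sub>R v) \<bullet> v)) (at t)"
    unfolding q by (auto intro!: derivative_eq_intros simp: algebra_simps)
next
  fix v
  show "((\<lambda>t. 2 * ((x - c + t *\<^sub>R v) \<bullet> v)) has_real_derivative v \<bullet> (2 *\<^sub>R v)) (at 0)"
    by (auto intro!: derivative_eq_intros simp: inner_add_left)
qed

lemma has_lap_inner:
  fixes x :: "'a::euclidean_space"
  shows "has_lap (\<lambda>x. (x - c) \<bullet> e) 0 x"
proof (rule has_lapI[where A="\<lambda>v. 0" and d="\<lambda>v t. v \<bullet> e"])
  fix v t
  show "((\<lambda>t. (x + t *\<^sub>R v - c) \<bullet> e) has_real_derivative v \<bullet> e) (at t)"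
    by (auto intro!: derivative_eq_intros simp: inner_add_left inner_diff_left)
qed (auto simp: linear_iff)

lemma has_lap_inner_square:
  fixes x :: "'a::euclidean_space"
  shows "has_lap (\<lambda>x. ((x - c) \<bullet> e)\<^sup>2) (2 * (e \<bullet> e)) x"
proof (rule has_lapI[where A="\<lambda>v. (2 * (v \<bullet> e)) *\<^sub>R e"
      and d="\<lambda>v t. 2 * ((x - c) \<bullet> e + t * (v \<bullet> e)) * (v \<bullet> e)"])
  show "linear (\<lambda>v::'a. (2 * (v \<bullet> e)) *\<^sub>R e)" by (simp add: linear_iff algebra_simps)
  show "2 * (e \<bullet> e) = (\<Sum>b\<in>Basis. b \<bullet> ((2 * (b \<bullet> e)) *\<^sub>R e))"
    unfolding euclidean_inner[of e e] by (simp add: sum_distrib_left inner_commute mult.assoc)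
  fix v t
  show "((\<lambda>t. ((x + t *\<^sub>R v - c) \<bullet> e)\<^sup>2) has_real_derivative
      2 * ((x - c) \<bullet> e + t * (v \<bullet> e)) * (v \<bullet> e)) (at t)"
    by (auto intro!: derivative_eq_intros simp: inner_add_left inner_diff_left algebra_simps)
next
  fix v
  show "((\<lambda>t. 2 * ((x - c) \<bullet> e + t * (v \<bullet> e)) * (v \<bullet> e)) has_real_derivative
      v \<bullet> (2 * (v \<bullet> e)) *\<^sub>R e) (at 0)"
    by (auto intro!: derivative_eq_intros simp: algebra_simps)
qed

text \<open>With \<open>E\<close> the value of the Gaussian and \<open>y = x - z\<close>, the
  Hessian is \<open>E\<close> times (4 a^2 y y^T - 2 a I). For \<open>a > 0\<close> the positive
  term wins away from \<open>z\<close>, which makes the Gaussian a subsolution there.\<close>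

lemma has_lap_gaussian:
  fixes x z :: "'a::euclidean_space"
  shows "has_lap (\<lambda>x. exp (- a * (norm (x - z))\<^sup>2))
    (exp (- a * (norm (x - z))\<^sup>2) * (4 * a\<^sup>2 * (norm (x - z))\<^sup>2 - 2 * a * DIM('a))) x"
proof -
  define y where "y = x - z"
  define E where "E = exp (- a * (norm y)\<^sup>2)"
  define q where "q = (\<lambda>v t. y \<bullet> y + 2 * t * (y \<bullet> v) + t\<^sup>2 * (v \<bullet> v))"
  have q: "(norm (x + t *\<^sub>R v - z))\<^sup>2 = q v t" for v t
    unfolding power2_norm_eq_inner q_def y_def
    by (simp add: algebra_simps inner_commute power2_eq_square)
  have q': "(q v has_real_derivative 2 * (y \<bullet> v) + 2 * t * (v \<bullet> v)) (at t)" for v t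
    unfolding q_def by (auto intro!: derivative_eq_intros)
  have q0: "exp (- (a * q v 0)) = E" for v
    by (simp add: q_def E_def power2_norm_eq_inner)
  show ?thesis
    unfolding y_def[symmetric] E_def[symmetric]
  proof (rule has_lapI[where A="\<lambda>v. E *\<^sub>R ((4 * a\<^sup>2 * (y \<bullet> v)) *\<^sub>R y - (2 * a) *\<^sub>R v)"
        and d="\<lambda>v t. exp (- a * q v t) * (- a * (2 * (y \<bullet> v) + 2 * t * (v \<bullet> v)))"])
    show "linear (\<lambda>v. E *\<^sub>R ((4 * a\<^sup>2 * (y \<bullet> v)) *\<^sub>R y - (2 * a) *\<^sub>R v))"
      by (simp add: linear_iff algebra_simps)
    have "(\<Sum>b\<in>Basis. (y \<bullet> b) * (y \<bullet> b)) = (norm y)\<^sup>2"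
      by (simp add: power2_norm_eq_inner euclidean_inner[of y y])
    then have "(\<Sum>b\<in>Basis. 4 * a\<^sup>2 * (y \<bullet> b) * (b \<bullet> y)) = 4 * a\<^sup>2 * (norm y)\<^sup>2"
      by (simp add: sum_distrib_left[symmetric] mult.assoc inner_commute)
    then show "E * (4 * a\<^sup>2 * (norm y)\<^sup>2 - 2 * a * DIM('a))
      = (\<Sum>b\<in>Basis. b \<bullet> (E *\<^sub>R ((4 * a\<^sup>2 * (y \<bullet> b)) *\<^sub>R y - (2 * a) *\<^sub>R b)))"
      by (simp add: inner_diff_right sum_subtractf sum_distrib_left[symmetric])
    fix v t
    show "((\<lambda>t. exp (- a * (norm (x + t *\<^sub>R v - z))\<^sup>2)) has_real_derivative
        exp (- a * q v t) * (- a * (2 * (y \<bullet> v) + 2 * t * (v \<bullet> v)))) (at t)"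
      unfolding q by (auto intro!: derivative_eq_intros q')
  next
    fix v
    show "((\<lambda>t. exp (- a * q v t) * (- a * (2 * (y \<bullet> v) + 2 * t * (v \<bullet> v)))) has_real_derivative
       v \<bullet> E *\<^sub>R ((4 * a\<^sup>2 * (y \<bullet> v)) *\<^sub>R y - (2 * a) *\<^sub>R v)) (at 0)"
      by (auto intro!: derivative_eq_intros q'
          simp: q0 inner_diff_right inner_commute algebra_simps power2_eq_square)
  qed
qed

text \<open>At a minimum all symmetric second differences are nonnegative, hence so are the
  quadratic form and its trace.\<close>

lemma has_lap_local_min:
  fixes x :: "'a::euclidean_space"
  assumes "has_lap w l x" "open S" "x \<in> S" "\<And>y. y \<in> S \<Longrightarrow> w x \<le> w y"
  shows "l \<ge> 0"
proof -
  obtain B where B: "linear B" "l = (\<Sum>b\<in>Basis. b \<bullet> B b)"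
      "\<And>h. ((\<lambda>t::real. (w (x + t *\<^sub>R h) + w (x - t *\<^sub>R h) - 2 * w x) / t\<^sup>2) \<longlongrightarrow> h \<bullet> B h) (at 0)"
    using assms unfolding has_lap_def by blast
  have "h \<bullet> B h \<ge> 0" for h
  proof (rule tendsto_lowerbound[OF B(3)])
    have "((\<lambda>t::real. x + t *\<^sub>R h) \<longlongrightarrow> x) (at 0)" "((\<lambda>t::real. x - t *\<^sub>R h) \<longlongrightarrow> x) (at 0)"
      by (auto intro!: tendsto_eq_intros)
    then have "\<forall>\<^sub>F t::real in at 0. x + t *\<^sub>R h \<in> S" "\<forall>\<^sub>F t::real in at 0. x - t *\<^sub>R h \<in> S"
      using assms(2,3) topological_tendstoD by blast+
    then show "\<forall>\<^sub>F t::real in at 0. 0 \<le> (w (x + t *\<^sub>R h) + w (x - t *\<^sub>R h) - 2 * w x) / t\<^sup>2"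
      by eventually_elim (use assms(4) in \<open>smt (verit) divide_nonneg_nonneg zero_le_power2\<close>)
  qed simp
  then show ?thesis unfolding B(2) by (simp add: sum_nonneg)
qed

section \<open>Reflections in hyperplanes\<close>

definition hyper_refl :: "'a::euclidean_space \<Rightarrow> real \<Rightarrow> 'a \<Rightarrow> 'a" where
  "hyper_refl e c x = x + (2 * (c - x \<bullet> e)) *\<^sub>R e"

lemma hyper_refl_inner: "norm e = 1 \<Longrightarrow> hyper_refl e c x \<bullet> e = 2 * c - x \<bullet> e"
  by (simp add: hyper_refl_def inner_add_left dot_square_norm)

lemma hyper_refl_hyper_refl: "norm e = 1 \<Longrightarrow> hyper_refl e c (hyper_refl e d x) = x + (2 * (c - d)) *\<^sub>R e"
proof -
  assume "norm e = 1"
  moreover have "2 * (c - d) = 2 * (d - x \<bullet> e) + 2 * (c - (2 * d - x \<bullet> e))" by simp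
  ultimately show ?thesis
    unfolding hyper_refl_def[of e c] by (simp only: hyper_refl_inner scaleR_left_distrib)
      (simp add: hyper_refl_def)
qed

lemma continuous_on_hyper_refl [continuous_intros]:
  "continuous_on S g \<Longrightarrow> continuous_on S h \<Longrightarrow> continuous_on S (\<lambda>s. hyper_refl e (g s) (h s))"
  unfolding hyper_refl_def by (intro continuous_intros)

text \<open>With \<open>R\<close> the linear part of the reflection, the new form is
  \<open>R B R\<close>. Its trace agrees with that of \<open>B\<close> because the corrections, -2,
  -2 and +4 times \<open>e \<bullet> B e\<close>, cancel.\<close>

lemma has_lap_hyper_refl:
  fixes x e :: "'a::euclidean_space"
  assumes "has_lap w l (hyper_refl e c x)" and e: "norm e = 1"
  shows "has_lap (\<lambda>x. w (hyper_refl e c x)) l x"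
proof -
  obtain B where B: "linear B" "l = (\<Sum>b\<in>Basis. b \<bullet> B b)"
      "\<And>h. ((\<lambda>t::real. (w (hyper_refl e c x + t *\<^sub>R h) + w (hyper_refl e c x - t *\<^sub>R h) - 2 * w (hyper_refl e c x)) / t\<^sup>2) \<longlongrightarrow> h \<bullet> B h) (at 0)"
    using assms(1) unfolding has_lap_def by blast
  define R where "R h = h - (2 * (h \<bullet> e)) *\<^sub>R e" for h :: 'a
  have linR: "linear R" unfolding R_def by (simp add: linear_iff algebra_simps)
  have R1: "hyper_refl e c (x + t *\<^sub>R h) = hyper_refl e c x + t *\<^sub>R R h" for t h
    by (simp add: hyper_refl_def R_def algebra_simps)
  have R2: "hyper_refl e c (x - t *\<^sub>R h) = hyper_refl e c x - t *\<^sub>R R h" for t h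
    by (simp add: hyper_refl_def R_def algebra_simps)
  have sym: "R h \<bullet> k = h \<bullet> R k" for h k
    by (simp add: R_def algebra_simps inner_commute)
  show ?thesis
    unfolding has_lap_def
  proof (intro exI conjI allI)
    show "linear (\<lambda>h. R (B (R h)))"
      using linear_compose[OF linear_compose[OF linR B(1)] linR] by (simp add: o_def)
    show "((\<lambda>t::real. (w (hyper_refl e c (x + t *\<^sub>R h)) + w (hyper_refl e c (x - t *\<^sub>R h)) - 2 * w (hyper_refl e c x)) / t\<^sup>2)
       \<longlongrightarrow> h \<bullet> R (B (R h))) (at 0)" for h
      using B(3)[of "R h"] by (simp add: R1 R2 sym)
    have BR: "B (R b) = B b - (2 * (b \<bullet> e)) *\<^sub>R B e" for b
      using B(1) by (simp add: R_def linear_diff linear_scale)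
    have eB: "(\<Sum>b\<in>Basis. (b \<bullet> e) * (e \<bullet> B b)) = e \<bullet> B e"
    proof -
      have "B e = (\<Sum>b\<in>Basis. (e \<bullet> b) *\<^sub>R B b)"
        using euclidean_representation[of e] B(1) linear_sum[OF B(1)] linear_scale[OF B(1)]
        by (metis (no_types, lifting) sum.cong)
      then show ?thesis by (simp add: inner_sum_right inner_commute)
    qed
    have eB': "(\<Sum>b\<in>Basis. (b \<bullet> e) * (b \<bullet> B e)) = e \<bullet> B e"
      unfolding euclidean_inner[of e "B e"] by (simp add: inner_commute)
    have ee: "(\<Sum>b\<in>Basis. (b \<bullet> e) * (b \<bullet> e)) = 1"
      using e euclidean_inner[of e e] by (simp add: inner_commute dot_square_norm)
    have "b \<bullet> R (B (R b)) = b \<bullet> B b - 2 * ((b \<bullet> e) * (b \<bullet> B e)) - 2 * ((b \<bullet> e) * (e \<bullet> B b))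
         + 4 * (e \<bullet> B e) * ((b \<bullet> e) * (b \<bullet> e))" for b
      unfolding BR unfolding R_def by (simp add: algebra_simps inner_commute)
    then have "(\<Sum>b\<in>Basis. b \<bullet> R (B (R b))) = l - 2 * (e \<bullet> B e) - 2 * (e \<bullet> B e) + 4 * (e \<bullet> B e) * 1"
      by (simp only: sum.distrib sum_subtractf sum_distrib_left[symmetric] eB eB' ee B(2))
    then show "l = (\<Sum>b\<in>Basis. b \<bullet> R (B (R b)))" by simp
  qed
qed

section \<open>From continuous partial derivatives to the pointwise Laplacian\<close>

text \<open>The increment is split into legs along the coordinate directions. The mean value theorem
  on each leg, with continuity of the partial derivatives, gives an error of at most
  \<open>\<eta> * norm h\<close> per leg.\<close>

lemma has_derivative_C1:
  fixes u :: "'a::euclidean_space \<Rightarrow> real"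
  assumes diff: "\<And>b x. b \<in> Basis \<Longrightarrow> (\<lambda>t::real. u (x + t *\<^sub>R b)) field_differentiable (at 0)"
    and cont: "\<And>b. b \<in> Basis \<Longrightarrow> continuous_on UNIV (partial_deriv b u)"
  shows "(u has_derivative (\<lambda>h. \<Sum>b\<in>Basis. (h \<bullet> b) * partial_deriv b u x)) (at x)"
proof -
  have line: "((\<lambda>t. u (y + t *\<^sub>R b)) has_real_derivative partial_deriv b u (y + t *\<^sub>R b)) (at t)"
    if b: "b \<in> Basis" for y b t
  proof -
    have "((\<lambda>s. u ((y + t *\<^sub>R b) + s *\<^sub>R b)) has_real_derivative partial_deriv b u (y + t *\<^sub>R b)) (at 0)"
      unfolding partial_deriv_def using diff[OF b] DERIV_deriv_iff_field_differentiable by blast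
    then show ?thesis
      using DERIV_shift[of "\<lambda>t. u (y + t *\<^sub>R b)" "partial_deriv b u (y + t *\<^sub>R b)" 0 t]
      by (simp add: algebra_simps)
  qed
  show ?thesis
    unfolding has_derivative_at_alt
  proof (intro conjI allI impI)
    show "bounded_linear (\<lambda>h. \<Sum>b\<in>Basis. (h \<bullet> b) * partial_deriv b u x)"
      by (intro bounded_linear_sum bounded_linear_mult_const bounded_linear_inner_left)
    fix \<delta> :: real assume "\<delta> > 0"
    define \<eta> where "\<eta> = \<delta> / DIM('a)"
    have "\<eta> > 0" using \<open>\<delta> > 0\<close> by (simp add: \<eta>_def)
    have "\<forall>b\<in>Basis. \<exists>r>0. \<forall>y. norm (y - x) < r \<longrightarrow> \<bar>partial_deriv b u y - partial_deriv b u x\<bar> < \<eta>"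
      using cont \<open>\<eta> > 0\<close> unfolding continuous_on_iff dist_norm real_norm_def by blast
    then obtain r where r: "\<And>b. b \<in> Basis \<Longrightarrow> r b > 0"
      "\<And>b y. b \<in> Basis \<Longrightarrow> norm (y - x) < r b \<Longrightarrow> \<bar>partial_deriv b u y - partial_deriv b u x\<bar> < \<eta>"
      by metis
    \<comment> \<open>Corners and mean value points of the path are only known to lie within
      \<open>DIM('a) * norm h\<close> of \<open>x\<close>, hence the division by the
      dimension.\<close>
    define r0 where "r0 = Min (r ` Basis) / DIM('a)"
    have "Min (r ` Basis) > 0" using r by (subst Min_gr_iff) auto
    then have "r0 > 0" by (simp add: r0_def)
    show "\<exists>d>0. \<forall>y. norm (y - x) < d \<longrightarrow>
      norm (u y - u x - (\<Sum>b\<in>Basis. ((y - x) \<bullet> b) * partial_deriv b u x)) \<le> \<delta> * norm (y - x)"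
    proof (intro exI[of _ r0] conjI allI impI)
      fix y assume y: "norm (y - x) < r0"
      define h where "h = y - x"
      have hb: "\<bar>h \<bullet> b\<bar> \<le> norm h" if "b \<in> Basis" for b using Basis_le_norm that by blast
      have small: "DIM('a) * norm h < r b" if "b \<in> Basis" for b
      proof -
        have "Min (r ` Basis) \<le> r b" using that by auto
        then show ?thesis using y unfolding r0_def h_def[symmetric]
          using that by (auto simp: field_simps)
      qed
      \<comment> \<open>The weights \<open>s\<close> also cover a path whose last leg is cut short
        at the mean value point.\<close>
      have norm_part: "norm (\<Sum>b\<in>B. (s b * (h \<bullet> b)) *\<^sub>R b) \<le> DIM('a) * norm h"
        if "B \<subseteq> Basis" "\<And>b. \<bar>s b\<bar> \<le> 1" for B and s :: "'a \<Rightarrow> real"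
      proof -
        have "norm (\<Sum>b\<in>B. (s b * (h \<bullet> b)) *\<^sub>R b) \<le> (\<Sum>b\<in>B. norm h)"
        proof (rule sum_norm_le)
          fix b assume "b \<in> B"
          then have "b \<in> Basis" using that by auto
          then show "norm ((s b * (h \<bullet> b)) *\<^sub>R b) \<le> norm h"
            using hb[of b] that(2)[of b] mult_mono[of "\<bar>s b\<bar>" 1 "\<bar>h \<bullet> b\<bar>" "norm h"] by (simp add: abs_mult)
        qed
        also have "\<dots> \<le> DIM('a) * norm h" using card_mono[OF finite_Basis that(1)]
          by (simp add: mult_right_mono)
        finally show ?thesis .
      qed
      have "\<bar>u (x + (\<Sum>b\<in>B. (h \<bullet> b) *\<^sub>R b)) - u x - (\<Sum>b\<in>B. (h \<bullet> b) * partial_deriv b u x)\<bar>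
           \<le> card B * (\<eta> * norm h)" if "B \<subseteq> Basis" for B
        using finite_subset[OF that finite_Basis] that
      proof (induction B rule: finite_induct)
        case empty then show ?case by simp
      next
        case (insert b B)
        define z where "z = x + (\<Sum>b\<in>B. (h \<bullet> b) *\<^sub>R b)"
        have b: "b \<in> Basis" using insert by auto
        have "\<exists>\<xi>. \<bar>\<xi>\<bar> \<le> 1 \<and> u (z + (h \<bullet> b) *\<^sub>R b) - u z = (h \<bullet> b) * partial_deriv b u (z + (\<xi> * (h \<bullet> b)) *\<^sub>R b)"
        proof -
          have D: "((\<lambda>s. u (z + (s * (h \<bullet> b)) *\<^sub>R b)) has_real_derivative
              partial_deriv b u (z + (s * (h \<bullet> b)) *\<^sub>R b) * (h \<bullet> b)) (at s)" for s
            by (rule DERIV_chain2[OF line[OF b]]) (auto intro!: derivative_eq_intros)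
          obtain \<xi> where "0 < \<xi>" "\<xi> < 1" "u (z + (1 * (h \<bullet> b)) *\<^sub>R b) - u (z + (0 * (h \<bullet> b)) *\<^sub>R b)
             = (1 - 0) * (partial_deriv b u (z + (\<xi> * (h \<bullet> b)) *\<^sub>R b) * (h \<bullet> b))"
            using MVT2[of 0 1, OF _ D] by auto
          then show ?thesis by (intro exI[of _ \<xi>]) (auto simp: mult.commute)
        qed
        then obtain \<xi> where \<xi>: "\<bar>\<xi>\<bar> \<le> 1"
          "u (z + (h \<bullet> b) *\<^sub>R b) - u z = (h \<bullet> b) * partial_deriv b u (z + (\<xi> * (h \<bullet> b)) *\<^sub>R b)" by blast
        have "norm (\<Sum>c\<in>insert b B. ((if c = b then \<xi> else 1) * (h \<bullet> c)) *\<^sub>R c) \<le> DIM('a) * norm h"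
          using insert.prems \<xi>(1) by (intro norm_part) auto
        moreover have "(\<Sum>c\<in>insert b B. ((if c = b then \<xi> else 1) * (h \<bullet> c)) *\<^sub>R c) = z + (\<xi> * (h \<bullet> b)) *\<^sub>R b - x"
        proof -
          have "(\<Sum>c\<in>B. ((if c = b then \<xi> else 1) * (h \<bullet> c)) *\<^sub>R c) = (\<Sum>c\<in>B. (h \<bullet> c) *\<^sub>R c)"
            using insert.hyps by (intro sum.cong) auto
          then show ?thesis using insert.hyps by (simp add: z_def)
        qed
        ultimately have "\<bar>partial_deriv b u (z + (\<xi> * (h \<bullet> b)) *\<^sub>R b) - partial_deriv b u x\<bar> \<le> \<eta>"
          using r(2)[OF b] small[OF b] by (smt (verit))
        then have "\<bar>h \<bullet> b\<bar> * \<bar>partial_deriv b u (z + (\<xi> * (h \<bullet> b)) *\<^sub>R b) - partial_deriv b u x\<bar> \<le> norm h * \<eta>"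
          using hb[OF b] by (intro mult_mono) auto
        then have "\<bar>u (z + (h \<bullet> b) *\<^sub>R b) - u z - (h \<bullet> b) * partial_deriv b u x\<bar> \<le> \<eta> * norm h"
          unfolding \<xi>(2) abs_mult[symmetric] by (simp add: algebra_simps)
        moreover have "\<bar>u z - u x - (\<Sum>b\<in>B. (h \<bullet> b) * partial_deriv b u x)\<bar> \<le> card B * (\<eta> * norm h)"
          unfolding z_def using insert by auto
        ultimately have "\<bar>u (z + (h \<bullet> b) *\<^sub>R b) - u x
            - ((h \<bullet> b) * partial_deriv b u x + (\<Sum>b\<in>B. (h \<bullet> b) * partial_deriv b u x))\<bar>
            \<le> \<eta> * norm h + card B * (\<eta> * norm h)" by linarith
        moreover have "x + (\<Sum>b\<in>insert b B. (h \<bullet> b) *\<^sub>R b) = z + (h \<bullet> b) *\<^sub>R b"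
          using insert.hyps by (simp add: z_def)
        moreover have "card (insert b B) * (\<eta> * norm h) = \<eta> * norm h + card B * (\<eta> * norm h)"
          using insert.hyps by (simp add: distrib_right)
        moreover have "(\<Sum>b\<in>insert b B. (h \<bullet> b) * partial_deriv b u x)
            = (h \<bullet> b) * partial_deriv b u x + (\<Sum>b\<in>B. (h \<bullet> b) * partial_deriv b u x)"
          using insert.hyps by simp
        ultimately show ?case by (simp only:)
      qed
      from this[of Basis] show "norm (u y - u x - (\<Sum>b\<in>Basis. ((y - x) \<bullet> b) * partial_deriv b u x)) \<le> \<delta> * norm (y - x)"
        by (simp add: euclidean_representation \<eta>_def h_def)
    qed (rule \<open>r0 > 0\<close>)
  qed
qed

lemma C_k_2_has_derivative:
  fixes u :: "'a::euclidean_space \<Rightarrow> real"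
  assumes "C_k 2 u"
  shows "(u has_derivative (\<lambda>h. \<Sum>b\<in>Basis. (h \<bullet> b) * partial_deriv b u x)) (at x)"
    and "b \<in> Basis \<Longrightarrow> continuous_on UNIV (partial_deriv b u)"
    and "b \<in> Basis \<Longrightarrow> (partial_deriv b u has_derivative
      (\<lambda>h. \<Sum>c\<in>Basis. (h \<bullet> c) * partial_deriv c (partial_deriv b u) x)) (at x)"
proof -
  show "(u has_derivative (\<lambda>h. \<Sum>b\<in>Basis. (h \<bullet> b) * partial_deriv b u x)) (at x)"
    using assms by (intro has_derivative_C1) (auto simp: numeral_2_eq_2)
  show "b \<in> Basis \<Longrightarrow> continuous_on UNIV (partial_deriv b u)"
    using assms by (auto simp: numeral_2_eq_2)
  show "b \<in> Basis \<Longrightarrow> (partial_deriv b u has_derivative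
      (\<lambda>h. \<Sum>c\<in>Basis. (h \<bullet> c) * partial_deriv c (partial_deriv b u) x)) (at x)"
    using assms by (intro has_derivative_C1) (auto simp: numeral_2_eq_2)
qed

lemma has_derivative_line:
  fixes u :: "'a::real_normed_vector \<Rightarrow> real"
  assumes "\<And>x. (u has_derivative (D x)) (at x)"
  shows "((\<lambda>t. u (x + t *\<^sub>R v)) has_real_derivative D (x + t *\<^sub>R v) v) (at t)"
proof -
  have "((\<lambda>t. u (x + t *\<^sub>R v)) has_derivative (\<lambda>s. D (x + t *\<^sub>R v) (s *\<^sub>R v))) (at t)"
    by (rule has_derivative_compose[OF _ assms]) (auto intro!: derivative_eq_intros)
  moreover have "D (x + t *\<^sub>R v) (s *\<^sub>R v) = D (x + t *\<^sub>R v) v * s" for s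
    using assms[of "x + t *\<^sub>R v"] linear_scale[OF has_derivative_linear] by (metis mult.commute real_scaleR_def)
  ultimately show ?thesis by (simp add: has_field_derivative_def)
qed

lemma has_lap_laplacian:
  fixes u :: "'a::euclidean_space \<Rightarrow> real"
  assumes "C_k 2 u"
  shows "has_lap u (laplacian u x) x"
proof (rule has_lapI[where A="\<lambda>v. \<Sum>b\<in>Basis. (\<Sum>c\<in>Basis. (v \<bullet> c) * partial_deriv c (partial_deriv b u) x) *\<^sub>R b"
      and d="\<lambda>v t. \<Sum>b\<in>Basis. (v \<bullet> b) * partial_deriv b u (x + t *\<^sub>R v)"])
  show "linear (\<lambda>v. \<Sum>b\<in>Basis. (\<Sum>c\<in>Basis. (v \<bullet> c) * partial_deriv c (partial_deriv b u) x) *\<^sub>R b)"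
    by (intro linear_compose_sum) (auto simp: linear_iff inner_add_left sum.distrib sum_distrib_left algebra_simps)
  show "((\<lambda>t. u (x + t *\<^sub>R v)) has_real_derivative (\<Sum>b\<in>Basis. (v \<bullet> b) * partial_deriv b u (x + t *\<^sub>R v))) (at t)" for v t
    by (rule has_derivative_line[OF C_k_2_has_derivative(1)[OF assms]])
  have one: "(\<Sum>c\<in>Basis. (b \<bullet> c) * g c) = g b" if "b \<in> Basis" for b :: 'a and g :: "'a \<Rightarrow> real"
    using that by (simp add: inner_Basis if_distrib[of "\<lambda>x. x * _"] sum.delta' cong: if_cong)
  show "laplacian u x = (\<Sum>b\<in>Basis. b \<bullet> (\<Sum>d\<in>Basis. (\<Sum>c\<in>Basis. (b \<bullet> c) * partial_deriv c (partial_deriv d u) x) *\<^sub>R d))"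
    unfolding laplacian_def by (intro sum.cong refl) (simp add: inner_sum_right one mult.commute)
  fix v
  have "((\<lambda>t. \<Sum>b\<in>Basis. (v \<bullet> b) * partial_deriv b u (x + t *\<^sub>R v)) has_real_derivative
     (\<Sum>b\<in>Basis. (v \<bullet> b) * (\<Sum>c\<in>Basis. (v \<bullet> c) * partial_deriv c (partial_deriv b u) (x + 0 *\<^sub>R v)))) (at 0)"
    by (intro DERIV_sum DERIV_cmult has_derivative_line[OF C_k_2_has_derivative(3)[OF assms]])
  then show "((\<lambda>t. \<Sum>b\<in>Basis. (v \<bullet> b) * partial_deriv b u (x + t *\<^sub>R v)) has_real_derivative
     v \<bullet> (\<Sum>b\<in>Basis. (\<Sum>c\<in>Basis. (v \<bullet> c) * partial_deriv c (partial_deriv b u) x) *\<^sub>R b)) (at 0)"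
    by (simp add: inner_sum_right mult.commute)
qed

section \<open>Barriers and maximum principles\<close>

text \<open>The Gaussian barrier of Hopf's lemma, shifted so as to vanish on the sphere of radius
  \<open>R\<close> about \<open>z\<close>.\<close>

definition bump :: "real \<Rightarrow> real \<Rightarrow> 'a::euclidean_space \<Rightarrow> 'a \<Rightarrow> real" where
  "bump a R z x = exp (- a * (norm (x - z))\<^sup>2) - exp (- a * R\<^sup>2)"

text \<open>For \<open>L \<ge> 0\<close> and radii \<open>r \<ge> \<rho>\<close>, the first
  condition makes the factor \<open>4 * a\<^sup>2 * r\<^sup>2 - 2 * a * n\<close> in the Laplacian
  of the Gaussian at least \<open>2 * a\<close>; the second makes this exceed
  \<open>L\<close>.\<close>

lemma barrier_rate_exists:
  fixes n \<rho> L :: real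
  assumes "\<rho> > 0"
  obtains a where "n + 1 \<le> 2 * a * \<rho>\<^sup>2" "L + 1 \<le> a"
proof
  define a where "a = max ((n + 1) / (2 * \<rho>\<^sup>2)) (L + 1)"
  have "a \<ge> (n + 1) / (2 * \<rho>\<^sup>2)" by (simp add: a_def)
  then show "n + 1 \<le> 2 * a * \<rho>\<^sup>2" using assms by (simp add: field_simps)
  show "L + 1 \<le> a" by (simp add: a_def)
qed

text \<open>The two conditions on \<open>a\<close> make \<^term>\<open>bump a R z\<close> a strict subsolution of \<open>\<Delta> - L\<close> outside the ball of
  radius \<open>\<rho>\<close>.\<close>

lemma annulus_barrier:
  fixes w :: "'a::euclidean_space \<Rightarrow> real"
  assumes \<rho>: "\<rho> > 0" and L: "L \<ge> 0"
    and a1: "real DIM('a) + 1 \<le> 2 * a * \<rho>\<^sup>2" and a2: "L + 1 \<le> a"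
    and cont: "continuous_on (cball z R) w"
    and lap: "\<And>x. norm (x - z) < R \<Longrightarrow> \<exists>l. has_lap w l x \<and> l \<le> L * w x"
    and out: "\<And>x. norm (x - z) = R \<Longrightarrow> w x \<ge> 0" and inn: "\<And>x. norm (x - z) = \<rho> \<Longrightarrow> w x \<ge> m"
    and m: "m > 0" and x: "\<rho> \<le> norm (x - z)" "norm (x - z) \<le> R"
  shows "w x \<ge> m * bump a R z x"
proof -
  define n where "n = real DIM('a)"
  have a1: "n + 1 \<le> 2 * a * \<rho>\<^sup>2" using a1 by (simp add: n_def)
  have "a > 0" using a2 L by simp
  define A where "A = cball z R - ball z \<rho>"
  have A: "y \<in> A \<longleftrightarrow> \<rho> \<le> norm (y - z) \<and> norm (y - z) \<le> R" for y
    by (auto simp: A_def dist_norm norm_minus_commute)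
  have "compact A" unfolding A_def by (intro compact_diff) auto
  moreover have "continuous_on A (\<lambda>y. w y - m * bump a R z y)"
    unfolding bump_def
    by (intro continuous_intros continuous_on_subset[OF cont]) (auto simp: A_def)
  ultimately obtain p where p: "p \<in> A" "\<And>y. y \<in> A \<Longrightarrow> w p - m * bump a R z p \<le> w y - m * bump a R z y"
    using continuous_attains_inf[of A "\<lambda>y. w y - m * bump a R z y"] x A[of x] by blast
  \<comment> \<open>A negative minimum avoids both spheres: \<open>bump\<close> is 0 on the outer
    one and at most 1 on the inner one. In the interior, \<open>L * w p \<le> L * m * E\<close>,
    which is less than the Laplacian of \<open>m * bump\<close>, so the difference would have
    negative Laplacian at its minimum.\<close>
  have "w p - m * bump a R z p \<ge> 0"
  proof (rule ccontr)
    assume neg: "\<not> w p - m * bump a R z p \<ge> 0"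
    have "norm (p - z) \<noteq> R"
    proof
      assume "norm (p - z) = R"
      then show False using neg out[of p] by (simp add: bump_def)
    qed
    moreover have "norm (p - z) \<noteq> \<rho>"
    proof
      assume eq: "norm (p - z) = \<rho>"
      have "exp (- a * \<rho>\<^sup>2) \<le> 1" using \<open>a > 0\<close> by simp
      then have "bump a R z p \<le> 1" using exp_gt_zero[of "- a * R\<^sup>2"] unfolding bump_def eq by linarith
      then have "m * bump a R z p \<le> m" using m by (simp add: mult_left_le)
      then show False using inn[OF eq] neg by simp
    qed
    ultimately have p': "\<rho> < norm (p - z)" "norm (p - z) < R" using p(1) A by auto
    obtain l where l: "has_lap w l p" "l \<le> L * w p" using lap p' by blast
    define E where "E = exp (- a * (norm (p - z))\<^sup>2)"
    have "E > 0" by (simp add: E_def)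
    have lapb: "has_lap (bump a R z) (E * (4 * a\<^sup>2 * (norm (p - z))\<^sup>2 - 2 * a * n)) p"
      using has_lap_diff[OF has_lap_gaussian has_lap_const]
      unfolding bump_def[abs_def] E_def n_def by fastforce
    have "L * E < E * (4 * a\<^sup>2 * (norm (p - z))\<^sup>2 - 2 * a * n)"
    proof -
      have "n + 1 \<le> 2 * a * (norm (p - z))\<^sup>2"
        using a1 \<open>a > 0\<close> p'(1) \<rho> power_mono[of \<rho> "norm (p - z)" 2]
        by (smt (verit) mult_left_mono mult_pos_pos)
      then have "2 * a * 1 \<le> 2 * a * (2 * a * (norm (p - z))\<^sup>2 - n)"
        using \<open>a > 0\<close> by (intro mult_left_mono) auto
      also have "\<dots> = 4 * a\<^sup>2 * (norm (p - z))\<^sup>2 - 2 * a * n"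
        by (simp add: algebra_simps power2_eq_square)
      finally have "L < 4 * a\<^sup>2 * (norm (p - z))\<^sup>2 - 2 * a * n" using a2 L by linarith
      then show ?thesis using \<open>E > 0\<close> by (simp add: mult.commute)
    qed
    then have s1: "m * (L * E) < m * (E * (4 * a\<^sup>2 * (norm (p - z))\<^sup>2 - 2 * a * n))"
      using m by (rule mult_strict_left_mono)
    have "has_lap (\<lambda>y. w y - m * bump a R z y) (l - m * (E * (4 * a\<^sup>2 * (norm (p - z))\<^sup>2 - 2 * a * n))) p"
      by (intro has_lap_diff has_lap_cmult l(1) lapb)
    then have "0 \<le> l - m * (E * (4 * a\<^sup>2 * (norm (p - z))\<^sup>2 - 2 * a * n))"
    proof (rule has_lap_local_min)
      show "open (ball z R - cball z \<rho>)" by (intro open_Diff) auto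
      show "p \<in> ball z R - cball z \<rho>" using p' by (simp add: dist_norm norm_minus_commute)
      fix y assume "y \<in> ball z R - cball z \<rho>"
      then have "y \<in> A" by (simp add: A_def)
      then show "w p - m * bump a R z p \<le> w y - m * bump a R z y" by (rule p(2))
    qed
    moreover have "L * w p \<le> L * (m * bump a R z p)" using neg L by (intro mult_left_mono) auto
    moreover have "L * (m * bump a R z p) \<le> L * (m * E)"
      using L m by (intro mult_left_mono) (auto simp: bump_def E_def)
    ultimately show False using l(2) s1 by (simp add: algebra_simps)
  qed
  then show "w x \<ge> m * bump a R z x" using p(2)[of x] x A by auto
qed

lemma bump_pos: "a > 0 \<Longrightarrow> norm (x - z) < R \<Longrightarrow> bump a R z x > 0"
  by (simp add: bump_def power_strict_mono)

text \<open>The zero set is relatively closed. It is open because a point \<open>q\<close> close to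
  a zero \<open>p\<close> with \<open>w q > 0\<close> would be the centre of an annulus barrier
  whose outer ball contains \<open>p\<close>, forcing \<open>w p > 0\<close>.\<close>

lemma strong_minimum_principle:
  fixes w :: "'a::euclidean_space \<Rightarrow> real"
  assumes S: "open S" "connected S" and cont: "continuous_on S w" and L: "L \<ge> 0"
    and lap: "\<And>x. x \<in> S \<Longrightarrow> \<exists>l. has_lap w l x \<and> l \<le> L * w x"
    and nonneg: "\<And>x. x \<in> S \<Longrightarrow> w x \<ge> 0" and p: "p \<in> S" "w p = 0" and q: "q \<in> S"
  shows "w q = 0"
proof -
  define Z where "Z = {x\<in>S. w x = 0}"
  have "closedin (top_of_set S) Z"
    unfolding Z_def using continuous_closedin_preimage_constant[OF cont] by simp
  moreover have "\<exists>r>0. ball p r \<subseteq> Z" if "p \<in> Z" for p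
  proof -
    have "p \<in> S" using that by (simp add: Z_def)
    then obtain d where d: "d > 0" "cball p d \<subseteq> S" using open_contains_cball_eq[OF S(1)] by blast
    \<comment> \<open>Half the radius, so that balls of radius \<open>r\<close> centred in
      \<open>ball p r\<close> stay inside \<open>S\<close>.\<close>
    define r where "r = d / 2"
    have "ball p r \<subseteq> Z"
    proof
      fix q assume q: "q \<in> ball p r"
      have sub: "cball q r \<subseteq> S"
      proof
        fix y assume "y \<in> cball q r"
        then have "dist p y \<le> d" using q dist_triangle[of p y q] by (simp add: r_def)
        then show "y \<in> S" using d by auto
      qed
      have "r > 0" using d by (simp add: r_def)
      then have qS: "q \<in> S" using sub by auto
      show "q \<in> Z"
      proof (rule ccontr)
        assume "q \<notin> Z"
        then have wq: "w q > 0" using qS nonneg[of q] by (auto simp: Z_def)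
        obtain \<rho> where \<rho>: "\<rho> > 0" "\<And>y. y \<in> S \<Longrightarrow> dist y q < \<rho> \<Longrightarrow> dist (w y) (w q) < w q / 2"
          using cont qS wq unfolding continuous_on_iff by (metis half_gt_zero)
        define \<sigma> where "\<sigma> = min (\<rho> / 2) (r / 2)"
        have \<sigma>: "\<sigma> > 0" "\<sigma> < \<rho>" "\<sigma> < r" using \<rho> \<open>r > 0\<close> by (auto simp: \<sigma>_def)
        have large: "w y \<ge> w q / 2" if "norm (y - q) \<le> \<sigma>" for y
        proof -
          have "y \<in> S" using sub that \<sigma> by (auto simp: dist_norm norm_minus_commute)
          then have "\<bar>w y - w q\<bar> < w q / 2" using \<rho>(2)[of y] that \<sigma> by (simp add: dist_norm)
          then show ?thesis by linarith
        qed
        obtain a where a: "real DIM('a) + 1 \<le> 2 * a * \<sigma>\<^sup>2" "L + 1 \<le> a"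
          using barrier_rate_exists[OF \<sigma>(1)] by blast
        have inS: "y \<in> S" if "norm (y - q) \<le> r" for y
          using sub that by (auto simp: dist_norm norm_minus_commute)
        have wp: "w p = 0" using \<open>p \<in> Z\<close> by (simp add: Z_def)
        have pq: "norm (p - q) < r" using q by (simp add: dist_norm)
        have "norm (p - q) > \<sigma>" using large[of p] wp wq by (cases "norm (p - q) \<le> \<sigma>") auto
        then have "norm (p - q) \<ge> \<sigma>" by simp
        then have "w p \<ge> w q / 2 * bump a r q p"
        proof (intro annulus_barrier[OF \<sigma>(1) L a])
          show "continuous_on (cball q r) w" using cont sub by (rule continuous_on_subset)
          show "\<exists>l. has_lap w l x \<and> l \<le> L * w x" if "norm (x - q) < r" for x
            using that by (intro lap inS) simp
          show "w x \<ge> 0" if "norm (x - q) = r" for x using that by (intro nonneg inS) simp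
        qed (use pq wq large in auto)
        moreover have "bump a r q p > 0" using a L pq by (intro bump_pos) auto
        ultimately show False using wp wq by (smt (verit) divide_pos_pos mult_pos_pos)
      qed
    qed
    then show ?thesis using d by (intro exI[of _ r]) (auto simp: r_def)
  qed
  then have "open Z" by (meson open_contains_ball)
  then have "openin (top_of_set S) Z"
    by (intro open_openin_trans S(1)) (auto simp: Z_def)
  ultimately have "Z = {} \<or> Z = S" using S(2) connected_clopen by blast
  then show ?thesis using p q by (auto simp: Z_def)
qed

text \<open>The barrier lives on the annulus about \<open>p + e\<close> with radii 1/2 and 1, whose
  outer sphere touches the plane at \<open>p\<close>. There it vanishes together with
  \<open>w\<close>, but with positive slope.\<close>

lemma Hopf_half_space:
  fixes w :: "'a::euclidean_space \<Rightarrow> real"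
  assumes e: "norm e = 1" and cont: "continuous_on UNIV w" and L: "L \<ge> 0"
    and lap: "\<And>x. x \<bullet> e > c \<Longrightarrow> \<exists>l. has_lap w l x \<and> l \<le> L * w x"
    and pos: "\<And>x. x \<bullet> e > c \<Longrightarrow> w x > 0" and zero: "\<And>x. x \<bullet> e = c \<Longrightarrow> w x = 0" and p: "p \<bullet> e = c"
    and D: "((\<lambda>t. w (p + t *\<^sub>R e)) has_real_derivative D) (at 0)"
  shows "D > 0"
proof -
  define z where "z = p + e"
  have ee: "e \<bullet> e = 1" using e by (simp add: dot_square_norm)
  have zc: "z \<bullet> e = c + 1" by (simp add: z_def inner_add_left p ee)
  have dev: "y \<bullet> e \<ge> c + 1 - norm (y - z)" for y
  proof -
    have "\<bar>(y - z) \<bullet> e\<bar> \<le> norm (y - z)" using Cauchy_Schwarz_ineq2[of "y - z" e] e by simp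
    then show ?thesis using zc by (simp add: inner_diff_left)
  qed
  obtain q where q: "q \<in> cball z (1/2)" "\<And>y. y \<in> cball z (1/2) \<Longrightarrow> w q \<le> w y"
    using continuous_attains_inf[of "cball z (1/2)" w] continuous_on_subset[OF cont] by auto
  have wq: "w q > 0"
    using q(1) dev[of q] by (intro pos) (auto simp: dist_norm norm_minus_commute)
  obtain a where a: "real DIM('a) + 1 \<le> 2 * a * (1/2)\<^sup>2" "L + 1 \<le> a"
    using barrier_rate_exists[of "1/2"] by auto
  have below: "w (p + t *\<^sub>R e) \<ge> w q * (exp (- a * (1 - t)\<^sup>2) - exp (- a))" if "0 \<le> t" "t \<le> 1/2" for t
  proof -
    have "p + t *\<^sub>R e - z = (t - 1) *\<^sub>R e" by (simp add: z_def algebra_simps)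
    then have nm: "norm (p + t *\<^sub>R e - z) = 1 - t" using e that by simp
    have "w (p + t *\<^sub>R e) \<ge> w q * bump a 1 z (p + t *\<^sub>R e)"
    proof (rule annulus_barrier[OF _ L a])
      show "continuous_on (cball z 1) w" using cont continuous_on_subset by blast
      show "\<exists>l. has_lap w l x \<and> l \<le> L * w x" if "norm (x - z) < 1" for x
        using that dev[of x] by (intro lap) auto
      show "w x \<ge> 0" if "norm (x - z) = 1" for x
        using that dev[of x] pos[of x] zero[of x] by (cases "x \<bullet> e = c") (auto simp: less_le)
      show "w q \<le> w x" if "norm (x - z) = 1/2" for x
        using that by (intro q(2)) (auto simp: dist_norm norm_minus_commute)
    qed (use wq nm that in auto)
    then show ?thesis unfolding bump_def nm by simp
  qed
  \<comment> \<open>\<open>g\<close> is nonnegative on [0, 1/2] and vanishes at 0, so its derivative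
    there is not negative. The subtracted term \<open>w q * (2 * a * exp (- a))\<close> is the slope
    of the barrier.\<close>
  define g where "g t = w (p + t *\<^sub>R e) - w q * (exp (- a * (1 - t)\<^sup>2) - exp (- a))" for t
  have g0: "g 0 = 0" by (simp add: g_def zero p)
  have "(g has_real_derivative D - w q * (2 * a * exp (- a))) (at 0)"
    unfolding g_def by (auto intro!: derivative_eq_intros D)
  then have "D - w q * (2 * a * exp (- a)) \<ge> 0"
  proof (rule contrapos_pp)
    assume neg: "\<not> D - w q * (2 * a * exp (- a)) \<ge> 0"
    show "\<not> (g has_real_derivative D - w q * (2 * a * exp (- a))) (at 0)"
    proof
      assume "(g has_real_derivative D - w q * (2 * a * exp (- a))) (at 0)"
      from DERIV_neg_dec_right[OF this] neg obtain d where d: "d > 0" "\<And>h. 0 < h \<Longrightarrow> h < d \<Longrightarrow> g h < g 0"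
        by auto
      define t where "t = min (d/2) (1/2)"
      have t: "0 < t" "t < d" "t \<le> 1/2" using d(1) by (auto simp: t_def)
      then have "g t < 0" using d(2)[of t] g0 by simp
      then show False using below[of t] t by (simp add: g_def)
    qed
  qed
  moreover have "w q * (2 * a * exp (- a)) > 0" using wq a L by simp
  ultimately show ?thesis by linarith
qed

text \<open>Compares the odd part of \<open>u\<close> about a hyperplane with a concave quadratic on a half ball;
  this replaces interior elliptic estimates.\<close>

lemma bounded_lap_local_Lipschitz:
  fixes u :: "'a::euclidean_space \<Rightarrow> real"
  assumes cont: "continuous_on UNIV u" and lap: "\<And>x. \<exists>l. has_lap u l x \<and> \<bar>l\<bar> \<le> K"
    and osc: "\<And>x y. \<bar>u x - u y\<bar> \<le> M"
  obtains C where "C \<ge> 0" "\<And>x y. dist x y \<le> 2 \<Longrightarrow> \<bar>u x - u y\<bar> \<le> C * dist x y"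
proof
  define n where "n = real DIM('a)"
  define C where "C = M * (1 + n) + (2 * K + 1)"
  have "K \<ge> 0" using lap by (meson abs_ge_zero order_trans)
  have "M \<ge> 0" using osc[of 0 0] by simp
  have "n \<ge> 1" by (simp add: n_def Suc_leI)
  show "C \<ge> 0" unfolding C_def using \<open>K \<ge> 0\<close> \<open>M \<ge> 0\<close> \<open>n \<ge> 1\<close> by simp
  \<comment> \<open>\<open>c\<close> is the midpoint of the two points compared and \<open>t\<close>
    half their distance; \<open>t \<le> 1\<close> is the source of the bound 2 on the
    distance.\<close>
  have key: "u (c + t *\<^sub>R e) - u (c - t *\<^sub>R e) \<le> C * t" if e: "norm e = 1" and t: "0 \<le> t" "t \<le> 1" for c e :: 'a and t
  proof -
    have ee: "e \<bullet> e = 1" using e by (simp add: dot_square_norm)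
    define k where "k = c \<bullet> e"
    define s where "s x = (x - c) \<bullet> e" for x
    \<comment> \<open>The Laplacian of \<psi> is
      \<open>2 * M * n - 2 * (M * n + K + 1/2) = - 2 * K - 1\<close>, while that of the odd part is
      at most \<open>2 * K\<close> in absolute value. The \<open>M\<close> term dominates the
      oscillation on the round boundary; on the flat one the odd part vanishes and \<psi> is
      nonnegative.\<close>
    define \<psi> where "\<psi> x = M * (norm (x - c))\<^sup>2 + ((M * n + K + 1/2) * s x - (M * n + K + 1/2) * (s x)\<^sup>2)" for x
    define v where "v x = \<psi> x - (u x - u (hyper_refl e k x))" for x
    define H where "H = cball c 1 \<inter> {x. e \<bullet> x \<ge> k}"
    have H: "x \<in> H \<longleftrightarrow> norm (x - c) \<le> 1 \<and> s x \<ge> 0" for x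
      by (auto simp: H_def s_def k_def inner_diff_left inner_commute[of e] dist_norm norm_minus_commute)
    have "compact H" unfolding H_def by (intro compact_Int_closed closed_halfspace_ge) auto
    moreover have "continuous_on H v"
      unfolding v_def \<psi>_def s_def
      by (intro continuous_intros continuous_on_compose2[OF cont]) auto
    moreover have "c \<in> H" by (simp add: H s_def)
    ultimately obtain p where p: "p \<in> H" "\<And>y. y \<in> H \<Longrightarrow> v p \<le> v y"
      using continuous_attains_inf[of H v] by blast
    have sle: "s x \<le> norm (x - c)" for x
      using norm_cauchy_schwarz[of "x - c" e] e by (simp add: s_def)
    have psi: "\<psi> x \<ge> M * (norm (x - c))\<^sup>2" if "x \<in> H" for x
    proof -
      have "(s x)\<^sup>2 \<le> s x" using that sle[of x] H by (simp add: power2_eq_square mult_left_le)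
      then have "(M * n + K + 1/2) * (s x)\<^sup>2 \<le> (M * n + K + 1/2) * s x"
        using \<open>K \<ge> 0\<close> \<open>M \<ge> 0\<close> \<open>n \<ge> 1\<close> by (intro mult_left_mono) auto
      then show ?thesis by (simp add: \<psi>_def)
    qed
    have "v p \<ge> 0"
    proof (rule ccontr)
      assume neg: "\<not> v p \<ge> 0"
      have "s p \<noteq> 0"
      proof
        assume "s p = 0"
        then have "hyper_refl e k p = p" by (simp add: hyper_refl_def s_def k_def inner_diff_left)
        then have "v p = \<psi> p" by (simp add: v_def)
        then show False using neg psi[OF p(1)] \<open>M \<ge> 0\<close> by (smt (verit) mult_nonneg_nonneg zero_le_power2)
      qed
      moreover have "norm (p - c) \<noteq> 1"
      proof
        assume "norm (p - c) = 1"
        then show False using neg psi[OF p(1)] osc[of p "hyper_refl e k p"] by (auto simp: v_def)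
      qed
      ultimately have p': "norm (p - c) < 1" "s p > 0" using p(1) H[of p] by auto
      obtain l l' where l: "has_lap u l p" "\<bar>l\<bar> \<le> K" "has_lap u l' (hyper_refl e k p)" "\<bar>l'\<bar> \<le> K"
        using lap by meson
      have "has_lap v (M * (2 * DIM('a)) + ((M * n + K + 1/2) * 0 - (M * n + K + 1/2) * (2 * (e \<bullet> e))) - (l - l')) p"
        unfolding v_def \<psi>_def s_def
        by (intro has_lap_diff has_lap_add has_lap_cmult has_lap_norm_square has_lap_inner
            has_lap_inner_square has_lap_hyper_refl l e)
      then have "0 \<le> M * (2 * DIM('a)) + ((M * n + K + 1/2) * 0 - (M * n + K + 1/2) * (2 * (e \<bullet> e))) - (l - l')"
      proof (rule has_lap_local_min)
        show "open (ball c 1 \<inter> {x. e \<bullet> x > k})" by (intro open_Int open_halfspace_gt) auto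
        show "p \<in> ball c 1 \<inter> {x. e \<bullet> x > k}"
          using p' by (auto simp: s_def k_def inner_diff_left inner_commute[of e] dist_norm norm_minus_commute)
        fix y assume "y \<in> ball c 1 \<inter> {x. e \<bullet> x > k}"
        then have "y \<in> H" by (auto simp: H_def)
        then show "v p \<le> v y" by (rule p(2))
      qed
      then show False using l by (simp add: ee n_def algebra_simps)
    qed
    define y where "y = c + t *\<^sub>R e"
    have sy: "s y = t" by (simp add: y_def s_def ee)
    have ny: "norm (y - c) = t" using t e by (simp add: y_def)
    have ry: "hyper_refl e k y = c - t *\<^sub>R e"
      by (simp add: hyper_refl_def y_def k_def inner_add_left ee algebra_simps flip: scaleR_2)
    have "0 \<le> v y" using \<open>v p \<ge> 0\<close> p(2)[of y] H sy ny t by fastforce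
    then have "u y - u (c - t *\<^sub>R e) \<le> M * t\<^sup>2 + ((M * n + K + 1/2) * t - (M * n + K + 1/2) * t\<^sup>2)"
      by (simp add: v_def \<psi>_def sy ny ry)
    also have "\<dots> \<le> M * t + (M * n + K + 1/2) * t"
    proof -
      have "t\<^sup>2 \<le> t" using t by (simp add: power2_eq_square mult_left_le)
      then have "M * t\<^sup>2 \<le> M * t" using \<open>M \<ge> 0\<close> by (intro mult_left_mono)
      moreover have "(M * n + K + 1/2) * t\<^sup>2 \<ge> 0" using \<open>K \<ge> 0\<close> \<open>M \<ge> 0\<close> \<open>n \<ge> 1\<close> by simp
      ultimately show ?thesis by linarith
    qed
    also have "\<dots> = (M + M * n + K + 1/2) * t" by (simp add: algebra_simps)
    also have "\<dots> \<le> C * t" unfolding C_def using t \<open>K \<ge> 0\<close> by (intro mult_right_mono) (auto simp: algebra_simps)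
    finally show ?thesis by (simp add: y_def)
  qed
  fix x y :: 'a assume d: "dist x y \<le> 2"
  have one: "u x - u y \<le> C * dist x y" if "dist x y \<le> 2" for x y
  proof (cases "x = y")
    case False
    define t where "t = norm (x - y) / 2"
    define e where "e = (1 / norm (x - y)) *\<^sub>R (x - y)"
    define c where "c = (1/2) *\<^sub>R (x + y)"
    have e: "norm e = 1" using False by (simp add: e_def)
    have te: "t *\<^sub>R e = (1/2) *\<^sub>R (x - y)" using False by (simp add: t_def e_def)
    have "c + t *\<^sub>R e = x" "c - t *\<^sub>R e = y"
      unfolding te c_def by (simp_all add: algebra_simps flip: scaleR_left_distrib)
    then have "u x - u y \<le> C * t" using key[OF e, of t c] that by (simp add: t_def dist_norm)
    also have "\<dots> \<le> C * dist x y" using \<open>C \<ge> 0\<close> by (intro mult_left_mono) (auto simp: t_def dist_norm)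
    finally show ?thesis .
  qed simp
  show "\<bar>u x - u y\<bar> \<le> C * dist x y" using one[of x y] one[of y x] d by (simp add: dist_commute abs_le_iff)
qed

section \<open>Moving planes\<close>

text \<open>\<open>G\<close> is the gradient of \<open>u\<close>, accessed through derivatives along
  lines. \<open>antimono\<close> is the integrated form of \<open>f' \<le> 0\<close> near 0.\<close>

locale semilinear_solution =
  fixes u :: "'a::euclidean_space \<Rightarrow> real" and f :: "real \<Rightarrow> real" and G :: "'a \<Rightarrow> 'a" and L \<epsilon> :: real
  assumes lap: "has_lap u (- f (u x)) x"
    and cont: "continuous_on UNIV u"
    and line_deriv: "((\<lambda>t. u (x + t *\<^sub>R v)) has_real_derivative G (x + t *\<^sub>R v) \<bullet> v) (at t)"
    and grad_cont: "continuous_on UNIV G"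
    and pos: "u x > 0"
    and L_nonneg: "L \<ge> 0"
    and Lipschitz: "\<bar>f (u x) - f (u y)\<bar> \<le> L * \<bar>u x - u y\<bar>"
    and eps_pos: "\<epsilon> > 0"
    and antimono: "0 < a \<Longrightarrow> a \<le> b \<Longrightarrow> b < \<epsilon> \<Longrightarrow> f b \<le> f a"
begin

section \<open>Harnack-type propagation of lower bounds\<close>

text \<open>The Lipschitz bound keeps \<open>u \<ge> \<eta> / 2\<close> on a ball about
  \<open>x\<close> whose radius \<rho> is the same for all \<open>x\<close>; the annulus barrier
  carries a fixed fraction of this out to distance \<open>D\<close>. Hence \<open>c\<close> is
  independent of \<open>x\<close>.\<close>

lemma lower_bound_propagates:
  assumes osc: "\<And>x y. \<bar>u x - u y\<bar> \<le> M" and K: "\<And>x. \<bar>f (u x)\<bar> \<le> K" and fL: "\<And>x. - f (u x) \<le> L * u x"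
    and \<eta>: "\<eta> > 0" and D: "D \<ge> 0"
  obtains c where "c > 0" "\<And>x y. dist x y \<le> D \<Longrightarrow> u x \<ge> \<eta> \<Longrightarrow> u y \<ge> c"
proof -
  have "\<exists>l. has_lap u l x \<and> \<bar>l\<bar> \<le> K" for x
    using lap[of x] K[of x] by (intro exI[of _ "- f (u x)"]) auto
  then obtain C where C: "C \<ge> 0" "\<And>x y. dist x y \<le> 2 \<Longrightarrow> \<bar>u x - u y\<bar> \<le> C * dist x y"
    using bounded_lap_local_Lipschitz[OF cont _ osc] by metis
  define \<rho> where "\<rho> = min 1 (\<eta> / (2 * (C + 1)))"
  have \<rho>: "\<rho> > 0" "\<rho> \<le> 1" using \<eta> C by (auto simp: \<rho>_def)
  have near: "u y \<ge> \<eta> / 2" if "u x \<ge> \<eta>" "norm (y - x) \<le> \<rho>" for x y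
  proof -
    have "\<bar>u x - u y\<bar> \<le> C * dist x y" using C(2) that \<rho> by (auto simp: dist_norm norm_minus_commute)
    also have "\<dots> \<le> (C + 1) * \<rho>" using C that by (intro mult_mono) (auto simp: dist_norm norm_minus_commute)
    also have "\<dots> \<le> (C + 1) * (\<eta> / (2 * (C + 1)))" using C by (intro mult_left_mono) (auto simp: \<rho>_def)
    also have "\<dots> = \<eta> / 2" using C by (simp add: field_simps)
    finally show ?thesis using that by linarith
  qed
  obtain a where a: "real DIM('a) + 1 \<le> 2 * a * \<rho>\<^sup>2" "L + 1 \<le> a"
    using barrier_rate_exists[OF \<rho>(1)] by blast
  have "a > 0" using a L_nonneg by simp
  \<comment> \<open>The outer radius \<open>D + 1\<close> keeps the barrier positive up to distance
    \<open>D\<close>; the entry \<open>\<eta> / 2\<close> serves points within \<rho> of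
    \<open>x\<close>, inside the annulus hole.\<close>
  define c where "c = min (\<eta> / 2) (\<eta> / 2 * (exp (- a * D\<^sup>2) - exp (- a * (D + 1)\<^sup>2)))"
  have "D\<^sup>2 < (D + 1)\<^sup>2" using D by (intro power_strict_mono) auto
  then have "c > 0" using \<eta> \<open>a > 0\<close> by (simp add: c_def)
  moreover have "u y \<ge> c" if "dist x y \<le> D" "u x \<ge> \<eta>" for x y
  proof (cases "norm (y - x) \<le> \<rho>")
    case True
    then have "u y \<ge> \<eta> / 2" by (rule near[OF that(2)])
    moreover have "c \<le> \<eta> / 2" by (simp add: c_def)
    ultimately show ?thesis by linarith
  next
    case False
    have d: "norm (y - x) \<le> D" using that by (simp add: dist_norm norm_minus_commute)
    have "u y \<ge> \<eta> / 2 * bump a (D + 1) x y"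
    proof (rule annulus_barrier[OF \<rho>(1) L_nonneg a])
      show "continuous_on (cball x (D + 1)) u" using cont continuous_on_subset by blast
      show "\<exists>l. has_lap u l z \<and> l \<le> L * u z" for z using lap[of z] fL[of z] by blast
    qed (use False d \<eta> near[OF that(2)] pos in \<open>auto intro: less_imp_le\<close>)
    moreover have "\<eta> / 2 * bump a (D + 1) x y \<ge> \<eta> / 2 * (exp (- a * D\<^sup>2) - exp (- a * (D + 1)\<^sup>2))"
      using \<eta> \<open>a > 0\<close> d D by (intro mult_left_mono) (auto simp: bump_def intro!: power_mono)
    ultimately show ?thesis by (simp add: c_def)
  qed
  ultimately show ?thesis by (rule that)
qed

section \<open>Reflected differences and the moving plane\<close>

text \<open>An upper bound expresses decay because \<open>u\<close> is positive.\<close>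

definition vanishes_on :: "'a set \<Rightarrow> bool" where
  "vanishes_on S \<longleftrightarrow> (\<forall>\<delta>>0. \<exists>R. \<forall>x\<in>S. norm x \<ge> R \<longrightarrow> u x < \<delta>)"

text \<open>The sign is chosen so that moving planes aim at a nonnegative value on the side
  \<open>x \<bullet> e \<ge> c\<close>.\<close>

definition refl_diff :: "'a \<Rightarrow> real \<Rightarrow> 'a \<Rightarrow> real" where
  "refl_diff e c x = u (hyper_refl e c x) - u x"

lemma continuous_on_refl_diff:
  "continuous_on S g \<Longrightarrow> continuous_on S h \<Longrightarrow> continuous_on S (\<lambda>s. refl_diff e (g s) (h s))"
  unfolding refl_diff_def
  by (intro continuous_intros continuous_on_compose2[OF cont]) auto

lemma has_lap_refl_diff:
  "norm e = 1 \<Longrightarrow> has_lap (refl_diff e c) (f (u x) - f (u (hyper_refl e c x))) x"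
  using has_lap_diff[OF has_lap_hyper_refl[OF lap[of "hyper_refl e c x"]] lap[of x]]
  unfolding refl_diff_def[abs_def] by simp

lemma refl_diff_plane: "x \<bullet> e = c \<Longrightarrow> refl_diff e c x = 0"
  by (simp add: refl_diff_def hyper_refl_def)

lemma refl_diff_gt: "refl_diff e c x > - u x"
  using pos[of "hyper_refl e c x"] by (simp add: refl_diff_def)

lemma refl_diff_refl: "norm e = 1 \<Longrightarrow> refl_diff e c (hyper_refl e c x) = - refl_diff e c x"
  by (simp add: refl_diff_def hyper_refl_hyper_refl)

text \<open>At a negative minimum with \<open>u < \<epsilon>\<close> both values of \<open>u\<close>
  lie where \<open>f\<close> is nonincreasing, so the difference is superharmonic nearby and must be
  locally constant. A minimiser nearest to the plane cannot allow this.\<close>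

lemma refl_diff_negative_point:
  assumes e: "norm e = 1" and van: "vanishes_on {x. x \<bullet> e \<ge> c}"
    and x0: "x0 \<bullet> e \<ge> c" "refl_diff e c x0 < 0"
  obtains p where "p \<bullet> e > c" "refl_diff e c p < 0" "u p \<ge> \<epsilon>"
proof -
  let ?w = "refl_diff e c"
  have cw: "continuous_on S ?w" for S
    using continuous_on_refl_diff[of S "\<lambda>_. c" "\<lambda>x. x" e] by auto
  \<comment> \<open>Since the difference exceeds \<open>- u\<close>, decay puts it strictly above
    its value at \<open>x0\<close> far out. So a minimum over the closed half space exists and every
    minimiser lies in \<open>K\<close>.\<close>
  obtain R where R: "\<And>x. x \<bullet> e \<ge> c \<Longrightarrow> norm x \<ge> R \<Longrightarrow> u x < - ?w x0"
    using van x0(2) unfolding vanishes_on_def by (metis (mono_tags) mem_Collect_eq neg_0_less_iff_less)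
  define K where "K = cball 0 (max R (norm x0)) \<inter> {x. e \<bullet> x \<ge> c}"
  have "compact K" unfolding K_def by (intro compact_Int_closed closed_halfspace_ge) auto
  moreover have x0K: "x0 \<in> K" using x0 by (auto simp: K_def inner_commute)
  ultimately obtain p0 where p0: "p0 \<in> K" "\<And>y. y \<in> K \<Longrightarrow> ?w p0 \<le> ?w y"
    using continuous_attains_inf[of K ?w] cw by blast
  define m where "m = ?w p0"
  have m: "m \<le> ?w x0" "m < 0" using p0(2)[OF x0K] x0 by (auto simp: m_def)
  have outside: "m < ?w x" if "x \<bullet> e \<ge> c" "norm x \<ge> R" for x
    using R[OF that] refl_diff_gt[of x e c] m by linarith
  have inK: "x \<in> K" if "x \<bullet> e \<ge> c" "\<not> norm x \<ge> R" for x
    using that by (auto simp: K_def inner_commute)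
  have min: "m \<le> ?w x" if "x \<bullet> e \<ge> c" for x
    using outside[OF that] inK[OF that] p0(2)[of x] by (cases "norm x \<ge> R") (auto simp: m_def)
  define Z where "Z = {x \<in> K. ?w x = m}"
  have "compact Z"
  proof -
    have "closedin (top_of_set K) Z"
      unfolding Z_def using continuous_closedin_preimage_constant[OF cw] by simp
    then show ?thesis using \<open>compact K\<close> closedin_compact by blast
  qed
  moreover have "p0 \<in> Z" using p0 by (simp add: Z_def m_def)
  moreover have "continuous_on Z (\<lambda>x. x \<bullet> e)" by (intro continuous_intros)
  ultimately obtain p where p: "p \<in> Z" "\<And>y. y \<in> Z \<Longrightarrow> p \<bullet> e \<le> y \<bullet> e"
    using continuous_attains_inf[of Z "\<lambda>x. x \<bullet> e"] by blast
  have pe: "p \<bullet> e > c"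
  proof -
    have "p \<bullet> e \<ge> c" using p by (auto simp: Z_def K_def inner_commute)
    moreover have "p \<bullet> e \<noteq> c" using refl_diff_plane[of p e c] p(1) m by (auto simp: Z_def)
    ultimately show ?thesis by simp
  qed
  have wp: "?w p = m" using p by (simp add: Z_def)
  have "u p \<ge> \<epsilon>"
  proof (rule ccontr)
    assume "\<not> u p \<ge> \<epsilon>"
    define U where "U = {x. e \<bullet> x > c} \<inter> {x. ?w x < 0} \<inter> {x. u x < \<epsilon>}"
    have "open U" unfolding U_def
      by (intro open_Int open_halfspace_gt open_Collect_less cw cont continuous_intros)
    moreover have "p \<in> U" using pe wp m \<open>\<not> u p \<ge> \<epsilon>\<close> by (auto simp: U_def inner_commute)
    ultimately obtain d where d: "d > 0" "ball p d \<subseteq> U" using open_contains_ball by blast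
    have "?w q - m = 0" if "q \<in> ball p d" for q
    proof (rule strong_minimum_principle[where S="ball p d" and L=0 and p=p])
      show "continuous_on (ball p d) (\<lambda>x. ?w x - m)" by (intro continuous_intros cw)
      fix x assume "x \<in> ball p d"
      then have x: "x \<bullet> e > c" "?w x < 0" "u x < \<epsilon>" using d by (auto simp: U_def inner_commute)
      have "has_lap (\<lambda>x. ?w x - m) (f (u x) - f (u (hyper_refl e c x)) - 0) x"
        by (intro has_lap_diff has_lap_const has_lap_refl_diff e)
      moreover have "f (u x) \<le> f (u (hyper_refl e c x))"
        using x pos by (intro antimono) (auto simp: refl_diff_def)
      ultimately show "\<exists>l. has_lap (\<lambda>x. ?w x - m) l x \<and> l \<le> 0 * (?w x - m)" by force
      show "0 \<le> ?w x - m" using min[of x] x by simp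
    qed (use d wp that in auto)
    \<comment> \<open>A step towards the plane that stays in the ball gives a minimiser nearer to
      the plane than \<open>p\<close>.\<close>
    moreover define q where "q = p - (d/2) *\<^sub>R e"
    moreover have "q \<in> ball p d" using d e by (simp add: q_def dist_norm)
    ultimately have "?w q = m" "q \<in> U" using d by auto
    then have "q \<bullet> e > c" by (simp add: U_def inner_commute)
    then have "q \<in> Z" using outside[of q] inK[of q] \<open>?w q = m\<close> by (auto simp: Z_def)
    from p(2)[OF this] show False
      using d e by (simp add: q_def inner_diff_left dot_square_norm)
  qed
  then show ?thesis using that pe wp m by simp
qed

text \<open>Planes advance from the far side down to \<open>c = Inf S\<close>. If they stop there
  without symmetry, negative points for planes just below \<open>c\<close> accumulate at a point
  \<open>q\<close> of the limiting plane, where the sign of the derivative of \<open>u\<close> along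
  \<open>e\<close> contradicts Hopf's lemma.\<close>

lemma symmetric_or_monotone_aux:
  assumes e: "norm e = 1" and van: "\<And>c. vanishes_on {x. x \<bullet> e \<ge> c}"
  shows "(\<exists>c. \<forall>x. refl_diff e c x = 0) \<or> (\<forall>c x. x \<bullet> e \<ge> c \<longrightarrow> refl_diff e c x \<ge> 0)"
proof (rule disjCI)
  assume "\<not> (\<forall>c x. x \<bullet> e \<ge> c \<longrightarrow> refl_diff e c x \<ge> 0)"
  define S where "S = {c. \<forall>\<mu>\<ge>c. \<forall>x. x \<bullet> e \<ge> \<mu> \<longrightarrow> refl_diff e \<mu> x \<ge> 0}"
  have up: "d \<in> S" if "c \<in> S" "c \<le> d" for c d using that by (auto simp: S_def)
  obtain c1 where c1: "c1 \<notin> S"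
    using \<open>\<not> (\<forall>c x. x \<bullet> e \<ge> c \<longrightarrow> refl_diff e c x \<ge> 0)\<close> unfolding S_def by blast
  have bdd: "bdd_below S" using c1 up by (intro bdd_belowI[of _ c1]) (meson linear)
  \<comment> \<open>A plane far enough out leaves no point with \<open>u \<ge> \<epsilon>\<close>
    beyond it, hence no negative value.\<close>
  have "S \<noteq> {}"
  proof -
    obtain R where R: "\<And>x. x \<bullet> e \<ge> 0 \<Longrightarrow> norm x \<ge> R \<Longrightarrow> u x < \<epsilon>"
      using van[of 0] eps_pos unfolding vanishes_on_def by (metis (mono_tags) mem_Collect_eq)
    have "refl_diff e \<mu> x \<ge> 0" if \<mu>: "\<mu> \<ge> max 0 R" "x \<bullet> e \<ge> \<mu>" for \<mu> x
    proof (rule ccontr)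
      assume "\<not> refl_diff e \<mu> x \<ge> 0"
      then obtain p where "p \<bullet> e > \<mu>" "u p \<ge> \<epsilon>"
        using refl_diff_negative_point[OF e van \<mu>(2)] by (metis not_le)
      moreover have "p \<bullet> e \<le> norm p" using norm_cauchy_schwarz[of p e] e by simp
      ultimately show False using R[of p] \<mu>(1) by simp
    qed
    then have "max 0 R \<in> S" by (auto simp: S_def)
    then show ?thesis by auto
  qed
  define c where "c = Inf S"
  have above: "\<mu> \<in> S" if "\<mu> > c" for \<mu>
    using cInf_lessD[OF \<open>S \<noteq> {}\<close>] that up unfolding c_def by (meson less_imp_le)
  have nonneg: "refl_diff e c x \<ge> 0" if "x \<bullet> e \<ge> c" for x
  proof (cases "x \<bullet> e = c")
    case False
    then have "x \<bullet> e > c" using that by simp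
    have "continuous_on UNIV (\<lambda>\<mu>. refl_diff e \<mu> x)" by (intro continuous_on_refl_diff continuous_intros)
    then have "isCont (\<lambda>\<mu>. refl_diff e \<mu> x) c" by (simp add: continuous_on_eq_continuous_at)
    then have "((\<lambda>\<mu>. refl_diff e \<mu> x) \<longlongrightarrow> refl_diff e c x) (at_right c)"
      unfolding isCont_def using filterlim_at_split by blast
    then show ?thesis
    proof (rule tendsto_lowerbound)
      show "\<forall>\<^sub>F \<mu> in at_right c. 0 \<le> refl_diff e \<mu> x"
        using eventually_at_right_less[of c] eventually_at_rightI[OF _ \<open>x \<bullet> e > c\<close>, of "\<lambda>\<mu>. 0 \<le> refl_diff e \<mu> x"]
          above unfolding S_def by fastforce
    qed simp
  qed (simp add: refl_diff_plane)
  \<comment> \<open>Positions tend to \<open>c\<close> from below by at most 1, so decay on the one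
    half space \<open>x \<bullet> e \<ge> c - 1\<close> bounds all these points.\<close>
  have "\<exists>c' p. c - 1 / real (Suc n) \<le> c' \<and> c' < c \<and> p \<bullet> e > c' \<and> refl_diff e c' p < 0 \<and> u p \<ge> \<epsilon>" for n
  proof -
    have "c - 1 / real (Suc n) \<notin> S" using cInf_lower[OF _ bdd, of "c - 1 / real (Suc n)"]
      by (auto simp: c_def field_simps)
    then obtain \<mu> x where \<mu>: "\<mu> \<ge> c - 1 / real (Suc n)" "x \<bullet> e \<ge> \<mu>" "refl_diff e \<mu> x < 0"
      by (auto simp: S_def not_le)
    have "\<mu> < c"
    proof (rule ccontr)
      assume "\<not> \<mu> < c"
      then consider "\<mu> = c" | "\<mu> \<in> S" using above[of \<mu>] by force
      then have "refl_diff e \<mu> x \<ge> 0" using \<mu>(2) nonneg[of x] by cases (auto simp: S_def)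
      then show False using \<mu>(3) by simp
    qed
    then show ?thesis using refl_diff_negative_point[OF e van \<mu>(2,3)] \<mu>(1) by metis
  qed
  then obtain cs p where cs: "\<And>n. c - 1 / real (Suc n) \<le> cs n" "\<And>n. cs n < c"
    and p: "\<And>n. p n \<bullet> e > cs n" "\<And>n. refl_diff e (cs n) (p n) < 0" "\<And>n. u (p n) \<ge> \<epsilon>"
    by metis
  have cs_lim: "cs \<longlonglongrightarrow> c"
  proof (rule tendsto_sandwich)
    show "(\<lambda>n. c - 1 / real (Suc n)) \<longlonglongrightarrow> c"
      using tendsto_diff[OF tendsto_const LIMSEQ_inverse_real_of_nat] by (simp add: inverse_eq_divide)
    show "(\<lambda>n. c) \<longlonglongrightarrow> c" by simp
  qed (use cs in \<open>auto intro: always_eventually less_imp_le\<close>)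
  obtain R where R: "\<And>x. x \<bullet> e \<ge> c - 1 \<Longrightarrow> norm x \<ge> R \<Longrightarrow> u x < \<epsilon>"
    using van[of "c - 1"] eps_pos unfolding vanishes_on_def by (metis (mono_tags) mem_Collect_eq)
  have "p n \<in> cball 0 R" for n
  proof -
    have "c - 1 \<le> c - 1 / real (Suc n)" by simp
    then have "p n \<bullet> e \<ge> c - 1" using cs(1)[of n] p(1)[of n] by linarith
    then show ?thesis using R[of "p n"] p(3)[of n] by (cases "norm (p n) \<ge> R") auto
  qed
  then obtain q r where r: "strict_mono r" and q: "(p \<circ> r) \<longlonglongrightarrow> q"
    using compact_cball[of "0::'a" R] unfolding compact_def by metis
  have q': "(\<lambda>n. p (r n)) \<longlonglongrightarrow> q" using q by (simp add: o_def)
  have c': "(\<lambda>n. cs (r n)) \<longlonglongrightarrow> c" using LIMSEQ_subseq_LIMSEQ[OF cs_lim r] by (simp add: o_def)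
  show "\<exists>c. \<forall>x. refl_diff e c x = 0"
  proof (rule ccontr)
    assume no: "\<not> (\<exists>c. \<forall>x. refl_diff e c x = 0)"
    let ?w = "refl_diff e c"
    have cw: "continuous_on S ?w" for S
      using continuous_on_refl_diff[of S "\<lambda>_. c" "\<lambda>x. x" e] by auto
    have lapw: "\<exists>l. has_lap ?w l x \<and> l \<le> L * ?w x" if "x \<bullet> e > c" for x
    proof -
      have "f (u x) - f (u (hyper_refl e c x)) \<le> L * \<bar>u x - u (hyper_refl e c x)\<bar>"
        using Lipschitz[of x "hyper_refl e c x"] by linarith
      moreover have "\<bar>u x - u (hyper_refl e c x)\<bar> = ?w x" using nonneg[of x] that by (simp add: refl_diff_def)
      ultimately show ?thesis using has_lap_refl_diff[OF e, of c x] by auto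
    qed
    have "\<exists>x. x \<bullet> e > c \<and> ?w x \<noteq> 0"
    proof (rule ccontr)
      assume *: "\<not> (\<exists>x. x \<bullet> e > c \<and> ?w x \<noteq> 0)"
      have "?w x = 0" for x
      proof (cases "x \<bullet> e" c rule: linorder_cases)
        case less
        then have "hyper_refl e c x \<bullet> e > c" using hyper_refl_inner[OF e, of c x] by simp
        then have "?w (hyper_refl e c x) = 0" using * by blast
        then show ?thesis using refl_diff_refl[OF e, of c x] by simp
      qed (use * refl_diff_plane in auto)
      then show False using no by blast
    qed
    then obtain y where y: "y \<bullet> e > c" "?w y \<noteq> 0" by blast
    have posw: "?w x > 0" if "x \<bullet> e > c" for x
    proof (rule ccontr)
      assume "\<not> ?w x > 0"
      then have "?w x = 0" using nonneg[of x] that by simp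
      have "?w y = 0"
      proof (rule strong_minimum_principle[where S="{x. e \<bullet> x > c}" and p=x])
        show "connected {x. e \<bullet> x > c}" by (intro convex_connected convex_halfspace_gt)
        show "open {x. e \<bullet> x > c}" by (rule open_halfspace_gt)
        show "\<And>x. x \<in> {x. e \<bullet> x > c} \<Longrightarrow> \<exists>l. has_lap ?w l x \<and> l \<le> L * ?w x"
          using lapw by (auto simp: inner_commute)
        show "\<And>x. x \<in> {x. e \<bullet> x > c} \<Longrightarrow> 0 \<le> ?w x" using nonneg by (auto simp: inner_commute)
      qed (use that y \<open>?w x = 0\<close> L_nonneg cw in \<open>auto simp: inner_commute\<close>)
      then show False using y by simp
    qed
    have "(\<lambda>n. refl_diff e (cs (r n)) (p (r n))) \<longlonglongrightarrow> ?w q"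
    proof -
      have "continuous_on UNIV (\<lambda>s. refl_diff e (fst s) (snd s))"
        by (intro continuous_on_refl_diff continuous_intros)
      then have "isCont (\<lambda>s. refl_diff e (fst s) (snd s)) (c, q)" by (simp add: continuous_on_eq_continuous_at)
      from isCont_tendsto_compose[OF this tendsto_Pair[OF c' q']] show ?thesis by simp
    qed
    then have "?w q \<le> 0" by (rule LIMSEQ_le_const2) (use p(2) in \<open>auto intro: less_imp_le\<close>)
    moreover have pe_lim: "(\<lambda>n. p (r n) \<bullet> e) \<longlonglongrightarrow> q \<bullet> e" by (intro tendsto_intros q')
    then have "c \<le> q \<bullet> e" by (rule LIMSEQ_le[OF c']) (use p(1) in \<open>auto intro: less_imp_le\<close>)
    \<comment> \<open>The limiting difference is positive strictly beyond the plane, so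
      \<open>q\<close> can only lie on it.\<close>
    ultimately have qc: "q \<bullet> e = c" using posw[of q] by linarith
    define s where "s n = 2 * (p (r n) \<bullet> e - cs (r n))" for n
    have s_lim: "s \<longlonglongrightarrow> 0"
      using tendsto_mult[OF tendsto_const[of 2] tendsto_diff[OF pe_lim c']] by (simp add: qc s_def[abs_def])
    \<comment> \<open>The reflection of \<open>p (r n)\<close> is its shift by \<open>- s n\<close>
      along \<open>e\<close>, where \<open>u\<close> is smaller; the mean value theorem finds a
      point in between with \<open>u\<close> increasing along \<open>e\<close>.\<close>
    have "\<exists>\<xi>. - s n < \<xi> \<and> \<xi> < 0 \<and> G (p (r n) + \<xi> *\<^sub>R e) \<bullet> e > 0" for n
    proof -
      have "s n > 0" using p(1)[of "r n"] by (simp add: s_def)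
      then obtain \<xi> where \<xi>: "- s n < \<xi>" "\<xi> < 0" "u (p (r n) + 0 *\<^sub>R e) - u (p (r n) + (- s n) *\<^sub>R e)
          = (0 - - s n) * (G (p (r n) + \<xi> *\<^sub>R e) \<bullet> e)"
        using MVT2[of "- s n" 0, OF _ line_deriv] by auto
      have "hyper_refl e (cs (r n)) (p (r n)) = p (r n) + (- s n) *\<^sub>R e"
        by (simp add: hyper_refl_def s_def algebra_simps)
      then have "u (p (r n) + 0 *\<^sub>R e) - u (p (r n) + (- s n) *\<^sub>R e) > 0"
        using p(2)[of "r n"] by (simp add: refl_diff_def)
      then have "s n * (G (p (r n) + \<xi> *\<^sub>R e) \<bullet> e) > 0" using \<xi>(3) by simp
      then have "G (p (r n) + \<xi> *\<^sub>R e) \<bullet> e > 0" using \<open>s n > 0\<close> by (rule zero_less_mult_pos)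
      then show ?thesis using \<xi>(1,2) by blast
    qed
    then obtain \<xi> where \<xi>: "\<And>n. - s n < \<xi> n" "\<And>n. \<xi> n < 0" "\<And>n. G (p (r n) + \<xi> n *\<^sub>R e) \<bullet> e > 0"
      by metis
    have "\<xi> \<longlonglongrightarrow> 0"
      by (rule tendsto_sandwich[of "\<lambda>n. - s n" _ _ "\<lambda>n. 0"])
        (use \<xi> tendsto_minus[OF s_lim] in \<open>auto intro: always_eventually less_imp_le\<close>)
    then have "(\<lambda>n. p (r n) + \<xi> n *\<^sub>R e) \<longlonglongrightarrow> q + 0 *\<^sub>R e" by (intro tendsto_intros q')
    then have "(\<lambda>n. p (r n) + \<xi> n *\<^sub>R e) \<longlonglongrightarrow> q" by simp
    then have "(\<lambda>n. G (p (r n) + \<xi> n *\<^sub>R e) \<bullet> e) \<longlonglongrightarrow> G q \<bullet> e"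
      using grad_cont by (intro tendsto_inner tendsto_const isCont_tendsto_compose[of q G])
        (auto simp: continuous_on_eq_continuous_at)
    then have ge: "G q \<bullet> e \<ge> 0" by (rule LIMSEQ_le_const) (use \<xi>(3) in \<open>auto intro: less_imp_le\<close>)
    \<comment> \<open>Reflection reverses \<open>e\<close>, so both terms of the difference
      contribute the same slope \<open>- (G q \<bullet> e)\<close> at \<open>q\<close>.\<close>
    have "- 2 * (G q \<bullet> e) > 0"
    proof (rule Hopf_half_space[OF e cw L_nonneg lapw posw refl_diff_plane qc])
      have "hyper_refl e c (q + t *\<^sub>R e) = q + (- t) *\<^sub>R e" for t
        using e qc by (simp add: hyper_refl_def inner_add_left dot_square_norm algebra_simps flip: scaleR_left_distrib)
      then have eq: "refl_diff e c (q + t *\<^sub>R e) = u (q + (- t) *\<^sub>R e) - u (q + t *\<^sub>R e)" for t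
        by (simp add: refl_diff_def)
      have "((\<lambda>t. u (q + (- t) *\<^sub>R e)) has_real_derivative (G (q + (- 0) *\<^sub>R e) \<bullet> e) * (- 1)) (at 0)"
        by (rule DERIV_chain2[of "\<lambda>t. u (q + t *\<^sub>R e)"], rule line_deriv) (auto intro!: derivative_eq_intros)
      from DERIV_diff[OF this line_deriv[of q e 0]]
      show "((\<lambda>t. refl_diff e c (q + t *\<^sub>R e)) has_real_derivative - 2 * (G q \<bullet> e)) (at 0)"
        by (simp add: eq)
    qed auto
    then show False using ge by simp
  qed
qed

text \<open>Monotonicity comes from the plane midway between \<open>x\<close> and
  \<open>x + t *\<^sub>R e\<close>, which exchanges the two points.\<close>

lemma symmetric_or_monotone:
  assumes e: "norm e = 1" and van: "\<And>c. vanishes_on {x. x \<bullet> e \<ge> c}"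
  obtains (symmetric) c where "\<And>x. u (hyper_refl e c x) = u x"
  | (monotone) "\<And>x t. t \<ge> 0 \<Longrightarrow> u (x + t *\<^sub>R e) \<le> u x"
  using symmetric_or_monotone_aux[OF e van]
proof
  assume "\<exists>c. \<forall>x. refl_diff e c x = 0"
  then show ?thesis using symmetric by (auto simp: refl_diff_def)
next
  assume *: "\<forall>c x. x \<bullet> e \<ge> c \<longrightarrow> refl_diff e c x \<ge> 0"
  have "u (x + t *\<^sub>R e) \<le> u x" if "t \<ge> 0" for x t
  proof -
    define c where "c = x \<bullet> e + t / 2"
    have "(x + t *\<^sub>R e) \<bullet> e = x \<bullet> e + t" using e by (simp add: inner_add_left dot_square_norm)
    then have "hyper_refl e c (x + t *\<^sub>R e) = x" "refl_diff e c (x + t *\<^sub>R e) \<ge> 0"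
      using that * by (auto simp: hyper_refl_def c_def)
    then show ?thesis by (simp add: refl_diff_def)
  qed
  then show ?thesis using monotone by blast
qed

section \<open>From decay to radial symmetry\<close>

lemma vanishes_on_subset: "vanishes_on T \<Longrightarrow> S \<subseteq> T \<Longrightarrow> vanishes_on S"
  unfolding vanishes_on_def by (meson subsetD)

lemma vanishes_on_ray:
  assumes "vanishes_on UNIV" "v \<noteq> 0" "\<delta> > 0"
  obtains t where "t > 0" "u (x + t *\<^sub>R v) < \<delta>"
proof -
  obtain R where R: "\<And>x. norm x \<ge> R \<Longrightarrow> u x < \<delta>"
    using assms unfolding vanishes_on_def by blast
  define t where "t = (\<bar>R\<bar> + norm x + 1) / norm v"
  have "t > 0" using assms by (simp add: t_def add_nonneg_pos)
  moreover have "norm (t *\<^sub>R v) = \<bar>R\<bar> + norm x + 1" using assms by (simp add: t_def)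
  then have "norm (x + t *\<^sub>R v) \<ge> R" using norm_diff_ineq[of "t *\<^sub>R v" x] by (simp add: add.commute)
  ultimately show ?thesis using that R by blast
qed

text \<open>Decay in the direction \<open>- e\<close> excludes monotonicity, so every direction has
  a mirror. The coordinate mirrors compose to the central symmetry about \<open>y\<close>, which
  forces every mirror through \<open>y\<close>; points equidistant from \<open>y\<close> are then
  exchanged by one of them.\<close>

lemma radial_if_vanishes:
  assumes van: "vanishes_on UNIV"
  shows "\<exists>y g. \<forall>x. u x = g (norm (x - y))"
proof -
  have "\<exists>c. \<forall>x. u (hyper_refl e c x) = u x" if e: "norm e = 1" for e
  proof (cases rule: symmetric_or_monotone[OF e vanishes_on_subset[OF van subset_UNIV]])
    case 2
    obtain t where t: "t > 0" "u (0 + t *\<^sub>R (- e)) < u 0"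
      by (rule vanishes_on_ray[OF van, of "- e" "u 0" 0]) (use e pos in auto)
    then show ?thesis using 2[of t "0 + t *\<^sub>R (- e)"] by simp
  qed blast
  then obtain c where c: "\<And>e x. norm e = 1 \<Longrightarrow> u (hyper_refl e (c e) x) = u x" by metis
  define y where "y = (\<Sum>b\<in>Basis. c b *\<^sub>R b)"
  have yb: "y \<bullet> b = c b" if "b \<in> Basis" for b using that by (simp add: y_def)
  have inv: "u (2 *\<^sub>R y - x) = u x" for x
  proof -
    have "u (x + (\<Sum>b\<in>B. (2 * (c b - x \<bullet> b)) *\<^sub>R b)) = u x" if "B \<subseteq> Basis" for B
      using finite_subset[OF that finite_Basis] that
    proof (induction B rule: finite_induct)
      case (insert b B)
      define z where "z = x + (\<Sum>b\<in>B. (2 * (c b - x \<bullet> b)) *\<^sub>R b)"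
      have "z \<bullet> b = x \<bullet> b"
        using insert by (auto simp: z_def inner_add_left inner_sum_left inner_Basis intro!: sum.neutral)
      then have "x + (\<Sum>b\<in>insert b B. (2 * (c b - x \<bullet> b)) *\<^sub>R b) = hyper_refl b (c b) z"
        using insert.hyps by (simp add: hyper_refl_def z_def add_ac)
      then show ?case using c[of b z] insert z_def by simp
    qed simp
    from this[of Basis] have "u (x + (\<Sum>b\<in>Basis. (2 * (c b - x \<bullet> b)) *\<^sub>R b)) = u x" by simp
    moreover have "(\<Sum>b\<in>Basis. (2 * (c b - x \<bullet> b)) *\<^sub>R b) = 2 *\<^sub>R (y - x)"
    proof -
      have "(\<Sum>b\<in>Basis. (2 * (c b - x \<bullet> b)) *\<^sub>R b) = (\<Sum>b\<in>Basis. ((2 *\<^sub>R (y - x)) \<bullet> b) *\<^sub>R b)"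
        by (intro sum.cong refl) (simp add: inner_diff_left yb)
      then show ?thesis by (simp only: euclidean_representation)
    qed
    moreover have "x + 2 *\<^sub>R (y - x) = 2 *\<^sub>R y - x" by (simp add: algebra_simps scaleR_2)
    ultimately show ?thesis by (simp only:)
  qed
  text \<open>The product of the reflections in a plane and in its mirror image under the central
    symmetry is a translation, which cannot fix a positive function vanishing at infinity.\<close>
  have center: "c e = y \<bullet> e" if e: "norm e = 1" for e
  proof (rule ccontr)
    assume ne: "c e \<noteq> y \<bullet> e"
    \<comment> \<open>The two mirrors are \<open>2 * (c e - y \<bullet> e)\<close> apart, and a
      product of parallel reflections translates by twice their separation.\<close>
    define a where "a = (4 * (c e - y \<bullet> e)) *\<^sub>R e"
    have "a \<noteq> 0" using ne e by (auto simp: a_def)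
    have per: "u (x + a) = u x" for x
    proof -
      have "hyper_refl e (c e) (2 *\<^sub>R y - hyper_refl e (c e) (2 *\<^sub>R y - x)) = x + a"
        using e by (simp add: hyper_refl_def a_def inner_add_left inner_diff_left dot_square_norm
            flip: scaleR_left_distrib scaleR_left_diff_distrib)
      then show ?thesis using c[OF e] inv by metis
    qed
    have mult: "u (real n *\<^sub>R a) = u 0" for n
    proof (induction n)
      case (Suc n)
      then show ?case using per[of "real n *\<^sub>R a"] by (simp add: algebra_simps)
    qed simp
    obtain R where R: "\<And>x. norm x \<ge> R \<Longrightarrow> u x < u 0"
      using van pos[of 0] unfolding vanishes_on_def by blast
    obtain n :: nat where "R < real n * norm a" using reals_Archimedean3 \<open>a \<noteq> 0\<close> by (metis zero_less_norm_iff)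
    then show False using R[of "real n *\<^sub>R a"] mult[of n] by simp
  qed
  have "u x = u x'" if "norm (x - y) = norm (x' - y)" for x x'
  proof (cases "x = x'")
    case False
    define e where "e = (1 / norm (x - x')) *\<^sub>R (x - x')"
    have e: "norm e = 1" using False by (simp add: e_def)
    have sq: "(x - y) \<bullet> (x - y) = (x' - y) \<bullet> (x' - y)" using that by (simp add: norm_eq)
    have "2 * ((y - x) \<bullet> (x - x')) = - ((x - x') \<bullet> (x - x'))"
      using sq by (simp add: inner_diff_left inner_diff_right inner_commute algebra_simps)
    then have "2 * ((y - x) \<bullet> (x - x')) = - (norm (x - x'))\<^sup>2" by (simp add: power2_norm_eq_inner)
    moreover have "y \<bullet> e - x \<bullet> e = ((y - x) \<bullet> (x - x')) / norm (x - x')"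
      by (simp add: e_def inner_diff_left diff_divide_distrib)
    ultimately have "2 * (y \<bullet> e - x \<bullet> e) = - norm (x - x')"
      using False by (simp add: power2_eq_square)
    \<comment> \<open>The mirror through \<open>y\<close> orthogonal to \<open>x - x'\<close> is the
      perpendicular bisector of the two points.\<close>
    then have "hyper_refl e (c e) x = x'"
      using False by (simp add: hyper_refl_def center[OF e]) (simp add: e_def)
    then show ?thesis using c[OF e, of x] by simp
  qed simp
  then have "u x = u (SOME z. norm (z - y) = norm (x - y))" for x
    by (metis (mono_tags, lifting) someI)
  then show ?thesis
    by (intro exI[of _ y] exI[of _ "\<lambda>r. u (SOME z. norm (z - y) = r)"]) blast
qed

lemma radial_if_vanishes_on_half_spaces:
  assumes k: "norm k = 1"
    and van: "\<And>e c. norm e = 1 \<Longrightarrow> e \<bullet> k > 0 \<Longrightarrow> vanishes_on {x. x \<bullet> e \<ge> c}"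
    and h: "h \<bullet> k = 0" "\<And>\<delta>. \<delta> > 0 \<Longrightarrow> \<exists>t. u (t *\<^sub>R h) < \<delta>"
  shows "\<exists>y g. \<forall>x. u x = g (norm (x - y))"
proof (cases "\<exists>e c. norm e = 1 \<and> e \<bullet> k > 0 \<and> (\<forall>x. u (hyper_refl e c x) = u x)")
  case True
  then obtain e c where e: "norm e = 1" "e \<bullet> k > 0" and sym: "\<And>x. u (hyper_refl e c x) = u x" by blast
  have "vanishes_on UNIV"
    unfolding vanishes_on_def
  proof (intro allI impI)
    fix \<delta> :: real assume "\<delta> > 0"
    then obtain R where R: "\<And>x. x \<bullet> e \<ge> c \<Longrightarrow> norm x \<ge> R \<Longrightarrow> u x < \<delta>"
      using van[OF e, of c] unfolding vanishes_on_def by blast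
    show "\<exists>R. \<forall>x\<in>UNIV. norm x \<ge> R \<longrightarrow> u x < \<delta>"
    proof (intro exI ballI impI)
      \<comment> \<open>The reflection preserves the distance to \<open>c *\<^sub>R e\<close>, a
        point of the plane, so it lowers the norm by at most
        \<open>2 * \<bar>c\<bar>\<close>.\<close>
      fix x :: 'a assume x: "norm x \<ge> max R (R + 2 * \<bar>c\<bar>)"
      show "u x < \<delta>"
      proof (cases "x \<bullet> e \<ge> c")
        case False
        define z where "z = x - c *\<^sub>R e"
        have "hyper_refl e c x - c *\<^sub>R e = z - (2 * (z \<bullet> e)) *\<^sub>R e"
          using e by (simp add: hyper_refl_def z_def inner_diff_left dot_square_norm algebra_simps)
        moreover have "(z - (2 * (z \<bullet> e)) *\<^sub>R e) \<bullet> (z - (2 * (z \<bullet> e)) *\<^sub>R e) = z \<bullet> z"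
          by (simp only: inner_diff_left inner_diff_right inner_scaleR_left inner_scaleR_right)
            (use e in \<open>simp add: dot_square_norm inner_commute algebra_simps\<close>)
        ultimately have "norm (hyper_refl e c x - c *\<^sub>R e) = norm z" by (simp only: norm_eq)
        moreover have "norm (c *\<^sub>R e) = \<bar>c\<bar>" using e by simp
        ultimately have "norm (hyper_refl e c x) \<ge> R"
          using x norm_triangle_ineq2[of x "c *\<^sub>R e"] norm_triangle_ineq4[of "hyper_refl e c x" "c *\<^sub>R e"]
          unfolding z_def by linarith
        then show ?thesis using R[of "hyper_refl e c x"] sym[of x] hyper_refl_inner[OF e(1), of c x] False
          by simp
      qed (use R x in auto)
    qed
  qed
  then show ?thesis by (rule radial_if_vanishes)
next
  case False
  have mono_pos: "u (x + v) \<le> u x" if "v \<bullet> k > 0" for x v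
  proof -
    have "v \<noteq> 0" using that by auto
    define e where "e = (1 / norm v) *\<^sub>R v"
    have e: "norm e = 1" "e \<bullet> k > 0" using \<open>v \<noteq> 0\<close> that by (auto simp: e_def)
    have "\<And>x t. t \<ge> 0 \<Longrightarrow> u (x + t *\<^sub>R e) \<le> u x"
      using symmetric_or_monotone[OF e(1) van[OF e]] False e by metis
    from this[of "norm v" x] show ?thesis using \<open>v \<noteq> 0\<close> by (simp add: e_def)
  qed
  \<comment> \<open>A direction orthogonal to \<open>k\<close> is the limit of
    \<open>v + s *\<^sub>R k\<close> as \<open>s\<close> decreases to 0.\<close>
  have mono: "u (x + v) \<le> u x" if "v \<bullet> k = 0" for x v
  proof (rule tendsto_upperbound)
    have "isCont u (x + v)" using cont by (simp add: continuous_on_eq_continuous_at)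
    moreover have "((\<lambda>s. x + (v + s *\<^sub>R k)) \<longlongrightarrow> x + v) (at_right 0)" by (auto intro!: tendsto_eq_intros)
    ultimately show "((\<lambda>s. u (x + (v + s *\<^sub>R k))) \<longlongrightarrow> u (x + v)) (at_right 0)"
      by (rule isCont_tendsto_compose)
    show "\<forall>\<^sub>F s in at_right 0. u (x + (v + s *\<^sub>R k)) \<le> u x"
      using eventually_at_right_less[of 0]
      by eventually_elim (use that k in \<open>auto intro!: mono_pos simp: inner_add_left dot_square_norm\<close>)
  qed simp
  obtain t where "u (t *\<^sub>R h) < u 0" using h(2) pos by blast
  \<comment> \<open>Returning to the origin is again a step orthogonal to \<open>k\<close>, so it
    cannot raise \<open>u\<close>, whatever the sign of \<open>t\<close>.\<close>
  moreover have "u (t *\<^sub>R h + - (t *\<^sub>R h)) \<le> u (t *\<^sub>R h)" by (rule mono) (simp add: h)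
  ultimately show ?thesis by simp
qed

end

section \<open>From the classical equation to the conclusion\<close>

text \<open>\<open>L\<close> bounds the derivative of \<open>f\<close> on the compact interval from
  0 to \<open>M\<close>, which contains the range of \<open>u\<close>. As 0 belongs to it,
  \<open>f 0 = 0\<close> turns the Lipschitz bound into the linear bound used by the
  barriers.\<close>

lemma solution_imp_semilinear_solution:
  fixes u :: "'a::euclidean_space \<Rightarrow> real"
  assumes f: "C_k 2 f" "f 0 = 0" and \<epsilon>: "\<epsilon> > 0" "\<forall>s\<in>{0<..<\<epsilon>}. deriv f s \<le> 0"
    and u: "C_k 2 u" "\<forall>x. u x > 0" and bdd: "\<And>x. u x \<le> M"
    and eq: "\<forall>x. - laplacian u x = f (u x)"
  obtains G L where "semilinear_solution u f G L \<epsilon>" "\<And>x. \<bar>f (u x)\<bar> \<le> L * u x"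
proof -
  define G where "G x = (\<Sum>b\<in>Basis. partial_deriv b u x *\<^sub>R b)" for x
  have f': "(f has_real_derivative deriv f x) (at x)" for x
    using has_derivative_line[OF C_k_2_has_derivative(1)[OF f(1)], of 0 1 x]
    by (simp add: partial_deriv_real)
  have f'_cont: "continuous_on UNIV (deriv f)"
    using C_k_2_has_derivative(2)[OF f(1), of 1] by (simp add: partial_deriv_real)
  have "compact ((\<lambda>s. \<bar>deriv f s\<bar>) ` {0..M})"
    by (intro compact_continuous_image continuous_intros continuous_on_subset[OF f'_cont]) auto
  then have "bdd_above ((\<lambda>s. \<bar>deriv f s\<bar>) ` {0..M})" by (intro bounded_imp_bdd_above compact_imp_bounded)
  then obtain L where "\<forall>s\<in>{0..M}. \<bar>deriv f s\<bar> \<le> L"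
    unfolding bdd_above_def by auto
  then have L: "\<bar>deriv f s\<bar> \<le> L" if "0 \<le> s" "s \<le> M" for s using that by simp
  have M: "M > 0" using u(2) bdd[of 0] by (meson less_le_trans)
  have L0: "L \<ge> 0" using L[of 0] M by simp
  have lip: "\<bar>f a - f b\<bar> \<le> L * \<bar>a - b\<bar>" if "a \<in> {0..M}" "b \<in> {0..M}" for a b
  proof -
    have "norm (f a - f b) \<le> L * norm (a - b)"
    proof (rule field_differentiable_bound[of "{0..M}" f "deriv f"])
      show "(f has_field_derivative deriv f z) (at z within {0..M})" for z
        using f' by (rule has_field_derivative_at_within)
    qed (use that L in auto)
    then show ?thesis by simp
  qed
  have range: "u x \<in> {0..M}" for x using u(2) bdd by (auto intro: less_imp_le)
  have "semilinear_solution u f G L \<epsilon>"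
  proof
    show "has_lap u (- f (u x)) x" for x using has_lap_laplacian[OF u(1), of x] eq by (metis minus_minus)
    show "continuous_on UNIV u" using u(1) by (simp add: numeral_2_eq_2)
    show "continuous_on UNIV G" unfolding G_def by (intro continuous_intros C_k_2_has_derivative(2)[OF u(1)])
    show "((\<lambda>t. u (x + t *\<^sub>R v)) has_real_derivative G (x + t *\<^sub>R v) \<bullet> v) (at t)" for x v t
      using has_derivative_line[OF C_k_2_has_derivative(1)[OF u(1)], of x v t]
      by (simp add: G_def inner_sum_left inner_commute[of v] mult.commute)
    show "\<bar>f (u x) - f (u y)\<bar> \<le> L * \<bar>u x - u y\<bar>" for x y by (intro lip range)
    show "f b \<le> f a" if "0 < a" "a \<le> b" "b < \<epsilon>" for a b
      using that \<epsilon>(2) by (intro DERIV_nonpos_imp_nonincreasing[of a b f]) (auto intro!: exI[of _ "deriv f _"] f')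
  qed (use L0 u(2) \<epsilon> in auto)
  moreover have "\<bar>f (u x)\<bar> \<le> L * u x" for x
    using lip[OF range[of x], of 0] f(2) M u(2) by (simp add: less_imp_le)
  ultimately show ?thesis by (rule that)
qed

theorem theorem8:
  fixes f :: "real \<Rightarrow> real"
    and u :: "(real ^ 'm) \<times> real \<Rightarrow> real"
    and \<epsilon> :: real
    and x0' :: "real ^ 'm"
  assumes "DIM((real ^ 'm) \<times> real) \<ge> 5"
    and "C_k 2 f"
    and "f 0 = 0"
    and "\<epsilon> > 0"
    and "\<forall>s\<in>{0<..<\<epsilon>}. deriv f s \<le> 0"
    and "C_k 2 u"
    and "\<forall>x. u x > 0"
    and "bounded (range u)"
    and "\<forall>x. - laplacian u x = f (u x)"
    and "uniform_limit UNIV (\<lambda>x' xN. u (x', xN)) (\<lambda>xN. 0) at_infinity"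
    and "((\<lambda>xN. u (x0', xN)) \<longlongrightarrow> 0) at_top"
  shows "\<exists>y. \<exists>g :: real \<Rightarrow> real. \<forall>x. u x = g (norm (x - y))"
proof -
  have pos: "u x > 0" for x using assms(7) by blast
  obtain M where M0: "\<And>x. norm (u x) \<le> M" using assms(8) unfolding bounded_iff by blast
  have M: "u x \<le> M" for x using M0[of x] unfolding real_norm_def by linarith
  obtain G L where "semilinear_solution u f G L \<epsilon>" and fL: "\<And>x. \<bar>f (u x)\<bar> \<le> L * u x"
    using solution_imp_semilinear_solution[OF assms(2-7) M assms(9)] by blast
  then interpret semilinear_solution u f G L \<epsilon> by simp
  have lateral: "\<exists>R. \<forall>x'. norm x' \<ge> R \<longrightarrow> (\<forall>xN. u (x', xN) < \<delta>)" if "\<delta> > 0" for \<delta>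
    using uniform_limitD[OF assms(10) that] pos
    unfolding eventually_at_infinity by (simp add: dist_real_def less_imp_le)
  \<comment> \<open>A point with \<open>u \<ge> \<delta>\<close> has bounded \<open>x'\<close>, so
    it is within a fixed distance of the given vertical line at the same height. There
    \<open>u \<ge> c\<close> would follow, which the decay along the line excludes at large
    heights.\<close>
  have upward: "\<exists>T. \<forall>x' xN. xN \<ge> T \<longrightarrow> u (x', xN) < \<delta>" if \<delta>: "\<delta> > 0" for \<delta>
  proof -
    obtain R where R: "\<And>x' xN. norm x' \<ge> R \<Longrightarrow> u (x', xN) < \<delta>" using lateral[OF \<delta>] by blast
    have osc: "\<bar>u x - u y\<bar> \<le> M" for x y using pos[of x] pos[of y] M[of x] M[of y] by linarith
    have fM: "\<bar>f (u x)\<bar> \<le> L * M" for x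
      using fL[of x] M[of x] L_nonneg by (meson mult_left_mono order_trans)
    have fu: "- f (u x) \<le> L * u x" for x using fL[of x] by linarith
    have "\<bar>R\<bar> + norm x0' \<ge> 0" by simp
    then obtain c where c: "c > 0"
      "\<And>x y. dist x y \<le> \<bar>R\<bar> + norm x0' \<Longrightarrow> u x \<ge> \<delta> \<Longrightarrow> u y \<ge> c"
      by (rule lower_bound_propagates[OF osc fM fu \<delta>]) (rule that)
    obtain T where T: "\<And>t. t \<ge> T \<Longrightarrow> u (x0', t) < c"
      using order_tendstoD(2)[OF assms(11) c(1)] unfolding eventually_at_top_linorder by blast
    have "u (x', t) < \<delta>" if "t \<ge> T" for x' t
    proof (rule ccontr)
      assume large: "\<not> u (x', t) < \<delta>"
      then have "norm x' < R" using R by (meson not_le)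
      then have "dist (x', t) (x0', t) \<le> \<bar>R\<bar> + norm x0'"
        using norm_triangle_ineq4[of x' x0'] by (simp add: dist_Pair_Pair dist_norm)
      then show False using c(2)[of "(x', t)" "(x0', t)"] large T[OF that] by simp
    qed
    then show ?thesis by blast
  qed
  have half_space: "vanishes_on {x. x \<bullet> e \<ge> c}"
    if e: "norm e = 1" "e \<bullet> (0, 1) > 0" for e :: "(real ^ 'm) \<times> real" and c
    unfolding vanishes_on_def
  proof (intro allI impI)
    fix \<delta> :: real assume "\<delta> > 0"
    obtain R where R: "\<And>x' t. norm x' \<ge> R \<Longrightarrow> u (x', t) < \<delta>" using lateral[OF \<open>\<delta> > 0\<close>] by blast
    obtain T where T: "\<And>x' t. t \<ge> T \<Longrightarrow> u (x', t) < \<delta>" using upward[OF \<open>\<delta> > 0\<close>] by blast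
    have e2: "snd e > 0" using e by (simp add: inner_prod_def)
    have e1: "norm (fst e) \<le> 1" using norm_fst_le[of "fst e" "snd e"] e by simp
    \<comment> \<open>Where \<open>u \<ge> \<delta>\<close>, \<open>x'\<close> is bounded by
      \<open>R\<close> and the height by \<open>T\<close> from above; since
      \<open>snd e > 0\<close>, the condition \<open>x \<bullet> e \<ge> c\<close> bounds the height
      from below by \<open>- ((\<bar>c\<bar> + \<bar>R\<bar>) / snd e)\<close>. \<open>Q\<close>
      exceeds every norm compatible with these bounds.\<close>
    define Q where "Q = \<bar>R\<bar> + \<bar>T\<bar> + (\<bar>c\<bar> + \<bar>R\<bar>) / snd e + 1"
    have "u x < \<delta>" if x: "x \<bullet> e \<ge> c" "norm x \<ge> Q" for x
    proof (rule ccontr)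
      assume large: "\<not> u x < \<delta>"
      have "norm (fst x) < R" using R[of "fst x" "snd x"] large by (cases "norm (fst x) < R") auto
      moreover have "snd x < T" using T[of "snd x" "fst x"] large by (cases "snd x < T") auto
      moreover have "snd x \<ge> - ((\<bar>c\<bar> + \<bar>R\<bar>) / snd e)"
      proof -
        have "fst x \<bullet> fst e \<le> norm (fst x) * norm (fst e)" by (rule norm_cauchy_schwarz)
        also have "\<dots> \<le> norm (fst x)" using e1 by (simp add: mult_left_le)
        finally have "snd x * snd e \<ge> - (\<bar>c\<bar> + \<bar>R\<bar>)"
          using x(1) \<open>norm (fst x) < R\<close> by (simp add: inner_prod_def)
        then have "- (\<bar>c\<bar> + \<bar>R\<bar>) / snd e \<le> snd x" using e2 by (simp add: pos_divide_le_eq)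
        then show ?thesis by (simp only: minus_divide_left)
      qed
      moreover have "norm x \<le> norm (fst x) + \<bar>snd x\<bar>" using norm_Pair_le[of "fst x" "snd x"] by simp
      moreover have "(\<bar>c\<bar> + \<bar>R\<bar>) / snd e \<ge> 0" using e2 by simp
      ultimately show False using x(2) unfolding Q_def by linarith
    qed
    then show "\<exists>R. \<forall>x\<in>{x. x \<bullet> e \<ge> c}. norm x \<ge> R \<longrightarrow> u x < \<delta>" by blast
  qed
  obtain b :: "real ^ 'm" where b: "b \<in> Basis" using nonempty_Basis by blast
  show ?thesis
  proof (rule radial_if_vanishes_on_half_spaces[where k="(0, 1)" and h="(b, 0)"])
    fix \<delta> :: real assume "\<delta> > 0"
    then obtain R where R: "\<And>x' t. norm x' \<ge> R \<Longrightarrow> u (x', t) < \<delta>" using lateral by blast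
    have "u (\<bar>R\<bar> *\<^sub>R (b, 0)) < \<delta>" using b by (auto intro!: R)
    then show "\<exists>t. u (t *\<^sub>R (b, 0)) < \<delta>" by blast
  qed (use half_space in \<open>auto simp: norm_Pair\<close>)
qed

end
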